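(* Let $a<b$ be real numbers, $\phi\in\mathcal A_2(a,b)$, let $\Omega\subset\mathbb R^d$ be a bounded convex smooth domain and $\gamma_\Omega:=\chi_\Omega\mathscr L^d$. For $c\in(a\mathscr L^d(\Omega),b\mathscr L^d(\Omega))$ define $$\mathcal M_{(a,b),c}(\Omega):=\{\mu\in\mathcal M(\overline\Omega):\ \mu=\rho\gamma_\Omega,\ a\le\rho\le b,\ \mu(\overline\Omega)=c\}.$$ Then for every such $c$ the space $\mathcal M_{(a,b),c}(\Omega)$ endowed with the distance $\mathcal W_{\phi,\gamma_\Omega}$ is bounded, i.e. $\sup\{\mathcal W_{\phi,\gamma_\Omega}(\mu_0,\mu_1):\mu_0,\mu_1\in\mathcal M_{(a,b),c}(\Omega)\}<+\infty$. In particular $\mathcal W_{\phi,\gamma_\Omega}(\mu_0,\mu_1)<+\infty$ for every $\mu_0,\mu_1\in\mathcal M_{(a,b),c}(\Omega)$.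
   Context: Notation. $\mathscr L^d$ is Lebesgue measure on $\mathbb R^d$; $\mathcal M_{\rm loc}(\mathbb R^d)$, $\mathcal M^+_{\rm loc}(\mathbb R^d)$, $\mathcal M_{\rm loc}(\mathbb R^d;\mathbb R^d)$ are the signed, non-negative, and $\mathbb R^d$-valued Radon measures on $\mathbb R^d$, with the weak* topology (duality with $C_c$). $\mathcal M(\overline\Omega)$ denotes the signed Radon measures on $\overline\Omega$, regarded as measures on $\mathbb R^d$ supported in $\overline\Omega$. Admissible densities: for $1<p<\infty$, $\mathcal A_p$ is the set of l.s.c. proper convex functions $\phi:\mathbb R\times\mathbb R^d\to[0,+\infty]$ such that (F1) for every $\rho$ with $(\{\rho\}\times\mathbb R^d)\cap\mathrm{dom}(\phi)\neq\emptyset$ one has $\phi(\rho,0)=0$ and $\phi(\rho,\lambda w)=|\lambda|^p\phi(\rho,w)$ for all $\lambda\ne0$, $w\in\mathbb R^d$; (F2) there is $\rho_0\in\mathbb R$ with $\{\rho_0\}\times\mathbb R^d\subseteq\mathrm{dom}(\phi)$ and $\phi(\rho_0,w)>0$ for all $w\neq0$. Here $\mathrm{dom}(\phi)=\{\phi<+\infty\}$. For real $a<b$, $\mathcal A_p(a,b)$ is the set of $\phi\in\mathcal A_p$ with $\mathrm{int}(\mathrm{dom}(\phi))=(a,b)\times\mathbb R^d$. In this statement $p=2$. Action functional: the recession function of $\phi$ is $\phi^\infty(y):=\sup\{\phi(x+y)-\phi(x):x\in\mathrm{dom}(\phi)\}$, $y\in\mathbb R\times\mathbb R^d$. Given $\gamma\in\mathcal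 M^+_{\rm loc}(\mathbb R^d)$, $\mu\in\mathcal M_{\rm loc}(\mathbb R^d)$, $\nu\in\mathcal M_{\rm loc}(\mathbb R^d;\mathbb R^d)$ with supports contained in $\mathrm{supp}(\gamma)$, write the Lebesgue decompositions $\mu=\rho\gamma+\mu^\perp$, $\nu=w\gamma+\nu^\perp$, choose $\sigma\in\mathcal M^+_{\rm loc}(\mathbb R^d)$, singular to $\gamma$, with $\mu^\perp=\rho^\perp\sigma$, $\nu^\perp=w^\perp\sigma$, and set $\Phi(\mu,\nu|\gamma):=\int\phi(\rho,w)\,d\gamma+\int\phi^\infty(\rho^\perp,w^\perp)\,d\sigma$ (independent of $\sigma$). Continuity equation: $\mathcal{CE}(0,T)$ is the set of families $(\mu_t,\nu_t)_{t\in[0,T]}$ with $t\mapsto\mu_t\in\mathcal M_{\rm loc}(\mathbb R^d)$ weakly* continuous on $[0,T]$, $(\nu_t)$ a Borel family in $\mathcal M_{\rm loc}(\mathbb R^d;\mathbb R^d)$, $\int_0^T|\mu_t|(B(0,R))\,dt<\infty$ and $\int_0^T|\nu_t|(B(0,R))\,dt<\infty$ for all $R>0$, and $\partial_t\mu_t+\mathrm{div}\,\nu_t=0$ in the sense of distributions on $\mathbb R^d\times(0,T)$, i.e. $\int_0^T\int\partial_t\zeta\,d\mu_t\,dt+\int_0^T\int\nabla_x\zeta\cdot d\nu_t\,dt=0$ for all $\zeta\in C^1_c(\mathbb R^d\times(0,T))$. $\mathcal{CE}_{\phi,\gamma}(0,1;\mu^0\to\mu^1)$ is the set of $(\mu,\nu)\in\mathcal{CE}(0,1)$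 with $\mu_{t=0}=\mu^0$, $\mu_{t=1}=\mu^1$, supports of $\mu_t,\nu_t$ in $\mathrm{supp}(\gamma)$ for a.e. $t$, and $\int_0^1\Phi(\mu_t,\nu_t|\gamma)\,dt<+\infty$. Distance: $\mathcal W_{\phi,\gamma}(\mu^0,\mu^1):=\inf\big\{\big(\int_0^1\Phi(\mu_t,\nu_t|\gamma)\,dt\big)^{1/p}:(\mu,\nu)\in\mathcal{CE}_{\phi,\gamma}(0,1;\mu^0\to\mu^1)\big\}$, equal to $+\infty$ if this set is empty. *)

theory Defs
  imports "HOL-Analysis.Analysis"
begin

section \<open>Radon measures\<close>

text \<open>
  A signed or vector-valued Radon measure on a Euclidean space, which may have infinite total
  mass, is represented by its values on bounded Borel sets, on which it is countably additive
  (finiteness of the total variation on bounded sets is then automatic). On all other sets the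
  representing function is 0, so that equality of measures is equality of functions.
\<close>

definition bounded_borel :: "'a::euclidean_space set set" where
  "bounded_borel = {B \<in> sets borel. bounded B}"

definition radon :: "('a::euclidean_space set \<Rightarrow> 'b::euclidean_space) \<Rightarrow> bool" where
  "radon \<mu> \<longleftrightarrow>
     (\<forall>A :: nat \<Rightarrow> 'a set. range A \<subseteq> bounded_borel \<and> disjoint_family A \<and> bounded (\<Union>n. A n)
        \<longrightarrow> (\<lambda>n. \<mu> (A n)) sums \<mu> (\<Union>n. A n)) \<and>
     (\<forall>B. B \<notin> bounded_borel \<longrightarrow> \<mu> B = 0)"

definition pos_radon :: "'a::euclidean_space measure \<Rightarrow> bool" where
  "pos_radon \<gamma> \<longleftrightarrow> sets \<gamma> = sets borel \<and> (\<forall>K. compact K \<longrightarrow> emeasure \<gamma> K < \<infinity>)"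

text \<open>Used both for functions satisfying \<^const>\<open>radon\<close> and for the \<^const>\<open>emeasure\<close> of a non-negative measure.\<close>

definition msupp :: "('a::euclidean_space set \<Rightarrow> 'b::zero) \<Rightarrow> 'a set" where
  "msupp \<mu> = {x. \<forall>r>0. \<exists>B\<in>sets borel. B \<subseteq> ball x r \<and> \<mu> B \<noteq> 0}"

definition total_variation ::
  "('a::euclidean_space set \<Rightarrow> 'b::euclidean_space) \<Rightarrow> 'a set \<Rightarrow> ennreal" where
  "total_variation \<mu> B =
     (SUP P \<in> {P. finite P \<and> P \<subseteq> sets borel \<and> disjoint P \<and> \<Union>P \<subseteq> B}.
        \<Sum>A\<in>P. ennreal (norm (\<mu> A)))"

text \<open>
  The positive part in the Jordan decomposition; \<^const>\<open>ennreal\<close> maps negative values to 0.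
\<close>

definition jordan_pos :: "('a::euclidean_space set \<Rightarrow> real) \<Rightarrow> 'a measure" where
  "jordan_pos \<mu> =
     measure_of UNIV (sets borel) (\<lambda>B. SUP A \<in> {A \<in> sets borel. A \<subseteq> B}. ennreal (\<mu> A))"

definition signed_integral :: "('a::euclidean_space set \<Rightarrow> real) \<Rightarrow> ('a \<Rightarrow> real) \<Rightarrow> real" where
  "signed_integral \<mu> f =
     (\<integral>x. f x \<partial>jordan_pos \<mu>) - (\<integral>x. f x \<partial>jordan_pos (\<lambda>B. - \<mu> B))"

text \<open>The scalar integral of \<open>g \<sqdot> d\<nu>\<close>.\<close>

definition vector_integral :: "('a::euclidean_space set \<Rightarrow> 'a) \<Rightarrow> ('a \<Rightarrow> 'a) \<Rightarrow> real" where
  "vector_integral \<nu> g = (\<Sum>i\<in>Basis. signed_integral (\<lambda>B. \<nu> B \<bullet> i) (\<lambda>x. g x \<bullet> i))"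

definition loc_integrable ::
  "'a::euclidean_space measure \<Rightarrow> ('a \<Rightarrow> 'b::euclidean_space) \<Rightarrow> bool" where
  "loc_integrable \<sigma> g \<longleftrightarrow>
     g \<in> borel_measurable borel \<and> (\<forall>B\<in>bounded_borel. set_integrable \<sigma> B g)"

text \<open>The measure \<open>g\<sigma>\<close>.\<close>

definition with_density ::
  "('a::euclidean_space \<Rightarrow> 'b::euclidean_space) \<Rightarrow> 'a measure \<Rightarrow> 'a set \<Rightarrow> 'b" where
  "with_density g \<sigma> = (\<lambda>B. if B \<in> bounded_borel then set_lebesgue_integral \<sigma> B g else 0)"

definition mutually_singular :: "'a::euclidean_space measure \<Rightarrow> 'a measure \<Rightarrow> bool" where
  "mutually_singular \<sigma> \<gamma> \<longleftrightarrow> (\<exists>N\<in>sets borel. emeasure \<gamma> N = 0 \<and> emeasure \<sigma> (- N) = 0)"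


section \<open>Admissible densities\<close>

definition edom :: "('c \<Rightarrow> ennreal) \<Rightarrow> 'c set" where
  "edom \<phi> = {x. \<phi> x < \<infinity>}"

definition lsc :: "('c::topological_space \<Rightarrow> ennreal) \<Rightarrow> bool" where
  "lsc \<phi> \<longleftrightarrow> (\<forall>x. \<phi> x \<le> Liminf (at x) \<phi>)"

text \<open>In \<^typ>\<open>ennreal\<close>, \<open>0 * \<infinity> = 0\<close>, so the endpoints of the segment are harmless.\<close>

definition econvex :: "('c::real_vector \<Rightarrow> ennreal) \<Rightarrow> bool" where
  "econvex \<phi> \<longleftrightarrow>
     (\<forall>x y. \<forall>u\<in>{0..1}. \<phi> ((1 - u) *\<^sub>R x + u *\<^sub>R y) \<le> ennreal (1 - u) * \<phi> x + ennreal u * \<phi> y)"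

definition admissible :: "real \<Rightarrow> (real \<times> 'a::euclidean_space \<Rightarrow> ennreal) set" where
  "admissible p = {\<phi>. lsc \<phi> \<and> edom \<phi> \<noteq> {} \<and> econvex \<phi> \<and>
     (\<forall>\<rho>. ({\<rho>} \<times> UNIV) \<inter> edom \<phi> \<noteq> {} \<longrightarrow>
        \<phi> (\<rho>, 0) = 0 \<and>
        (\<forall>l w. l \<noteq> 0 \<longrightarrow> \<phi> (\<rho>, l *\<^sub>R w) = ennreal (\<bar>l\<bar> powr p) * \<phi> (\<rho>, w))) \<and>
     (\<exists>\<rho>0. {\<rho>0} \<times> UNIV \<subseteq> edom \<phi> \<and> (\<forall>w. w \<noteq> 0 \<longrightarrow> \<phi> (\<rho>0, w) > 0))}"

definition admissible_on ::
  "real \<Rightarrow> real \<Rightarrow> real \<Rightarrow> (real \<times> 'a::euclidean_space \<Rightarrow> ennreal) set" where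
  "admissible_on p a b = {\<phi> \<in> admissible p. interior (edom \<phi>) = {a<..<b} \<times> UNIV}"


section \<open>The action functional\<close>

text \<open>The differences may be negative, hence the passage to \<^typ>\<open>ereal\<close>.\<close>

definition recession :: "('c::real_vector \<Rightarrow> ennreal) \<Rightarrow> 'c \<Rightarrow> ereal" where
  "recession \<phi> y = (SUP x\<in>edom \<phi>. enn2ereal (\<phi> (x + y)) - enn2ereal (\<phi> x))"

text \<open>
  \<open>\<mu> = \<rho>\<gamma> + \<rho>s\<sigma>\<close> and \<open>\<nu> = w\<gamma> + ws\<sigma>\<close> with \<open>\<sigma>\<close> singular to \<open>\<gamma>\<close>. Such a decomposition always
  exists, with \<open>\<rho>\<close>, \<open>w\<close>, \<open>\<rho>s\<sigma>\<close> and \<open>ws\<sigma>\<close> unique, but \<open>\<sigma>\<close> is not.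
\<close>

definition lebesgue_decomp ::
  "('a::euclidean_space set \<Rightarrow> real) \<Rightarrow> ('a set \<Rightarrow> 'a) \<Rightarrow> 'a measure \<Rightarrow>
   ('a \<Rightarrow> real) \<Rightarrow> ('a \<Rightarrow> 'a) \<Rightarrow> 'a measure \<Rightarrow> ('a \<Rightarrow> real) \<Rightarrow> ('a \<Rightarrow> 'a) \<Rightarrow> bool" where
  "lebesgue_decomp \<mu> \<nu> \<gamma> \<rho> w \<sigma> \<rho>s ws \<longleftrightarrow>
     pos_radon \<sigma> \<and> mutually_singular \<sigma> \<gamma> \<and>
     loc_integrable \<gamma> \<rho> \<and> loc_integrable \<gamma> w \<and> loc_integrable \<sigma> \<rho>s \<and> loc_integrable \<sigma> ws \<and>
     \<mu> = (\<lambda>B. with_density \<rho> \<gamma> B + with_density \<rho>s \<sigma> B) \<and>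
     \<nu> = (\<lambda>B. with_density w \<gamma> B + with_density ws \<sigma> B)"

text \<open>
  The value does not depend on the decomposition chosen by \<open>SOME\<close>, because \<^term>\<open>recession \<phi>\<close> is
  positively 1-homogeneous. It is also non-negative, so \<^const>\<open>e2ennreal\<close> loses nothing.
\<close>

definition action ::
  "(real \<times> 'a::euclidean_space \<Rightarrow> ennreal) \<Rightarrow> ('a set \<Rightarrow> real) \<Rightarrow> ('a set \<Rightarrow> 'a) \<Rightarrow>
   'a measure \<Rightarrow> ennreal" where
  "action \<phi> \<mu> \<nu> \<gamma> =
     (SOME r. \<exists>\<rho> w \<sigma> \<rho>s ws. lebesgue_decomp \<mu> \<nu> \<gamma> \<rho> w \<sigma> \<rho>s ws \<and>
        r = (\<integral>\<^sup>+ x. \<phi> (\<rho> x, w x) \<partial>\<gamma>) + (\<integral>\<^sup>+ x. e2ennreal (recession \<phi> (\<rho>s x, ws x)) \<partial>\<sigma>))"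


section \<open>The continuity equation and the distance\<close>

fun Ck :: "nat \<Rightarrow> ('c::real_normed_vector \<Rightarrow> real) \<Rightarrow> bool" where
  "Ck 0 f \<longleftrightarrow> continuous_on UNIV f"
| "Ck (Suc k) f \<longleftrightarrow>
     (\<forall>x. f differentiable (at x)) \<and> (\<forall>v. Ck k (\<lambda>x. frechet_derivative f (at x) v))"

definition supp_fun :: "('c::topological_space \<Rightarrow> real) \<Rightarrow> 'c set" where
  "supp_fun f = closure {x. f x \<noteq> 0}"

definition dt :: "('a::euclidean_space \<times> real \<Rightarrow> real) \<Rightarrow> real \<Rightarrow> 'a \<Rightarrow> real" where
  "dt \<zeta> t x = frechet_derivative \<zeta> (at (x, t)) (0, 1)"

definition grad_x :: "('a::euclidean_space \<times> real \<Rightarrow> real) \<Rightarrow> real \<Rightarrow> 'a \<Rightarrow> 'a" where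
  "grad_x \<zeta> t x = (\<Sum>i\<in>Basis. frechet_derivative \<zeta> (at (x, t)) (i, 0) *\<^sub>R i)"

definition weakstar_continuous_on ::
  "real set \<Rightarrow> (real \<Rightarrow> 'a::euclidean_space set \<Rightarrow> real) \<Rightarrow> bool" where
  "weakstar_continuous_on I \<mu> \<longleftrightarrow>
     (\<forall>f. continuous_on UNIV f \<and> compact (supp_fun f)
        \<longrightarrow> continuous_on I (\<lambda>t. signed_integral (\<mu> t) f))"

definition borel_family ::
  "real set \<Rightarrow> (real \<Rightarrow> 'a::euclidean_space set \<Rightarrow> 'b::euclidean_space) \<Rightarrow> bool" where
  "borel_family I \<nu> \<longleftrightarrow>
     (\<forall>B\<in>bounded_borel. (\<lambda>t. \<nu> t B) \<in> borel_measurable (restrict_space borel I))"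

definition CE ::
  "real \<Rightarrow> ((real \<Rightarrow> 'a::euclidean_space set \<Rightarrow> real) \<times> (real \<Rightarrow> 'a set \<Rightarrow> 'a)) set" where
  "CE T = {(\<mu>, \<nu>).
     (\<forall>t\<in>{0..T}. radon (\<mu> t) \<and> radon (\<nu> t)) \<and>
     weakstar_continuous_on {0..T} \<mu> \<and>
     borel_family {0..T} \<nu> \<and>
     (\<forall>R>0. (\<integral>\<^sup>+ t\<in>{0..T}. total_variation (\<mu> t) (ball 0 R) \<partial>lborel) < \<infinity> \<and>
            (\<integral>\<^sup>+ t\<in>{0..T}. total_variation (\<nu> t) (ball 0 R) \<partial>lborel) < \<infinity>) \<and>
     (\<forall>\<zeta>. Ck 1 \<zeta> \<and> compact (supp_fun \<zeta>) \<and> supp_fun \<zeta> \<subseteq> UNIV \<times> {0<..<T} \<longrightarrow>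
        (LINT t:{0..T}|lborel. signed_integral (\<mu> t) (dt \<zeta> t)) +
        (LINT t:{0..T}|lborel. vector_integral (\<nu> t) (grad_x \<zeta> t)) = 0)}"

definition CE_action ::
  "(real \<times> 'a::euclidean_space \<Rightarrow> ennreal) \<Rightarrow> 'a measure \<Rightarrow> ('a set \<Rightarrow> real) \<Rightarrow> ('a set \<Rightarrow> real) \<Rightarrow>
   ((real \<Rightarrow> 'a set \<Rightarrow> real) \<times> (real \<Rightarrow> 'a set \<Rightarrow> 'a)) set" where
  "CE_action \<phi> \<gamma> \<mu>0 \<mu>1 = {(\<mu>, \<nu>) \<in> CE 1.
     \<mu> 0 = \<mu>0 \<and> \<mu> 1 = \<mu>1 \<and>
     (AE t in lborel. t \<in> {0..1} \<longrightarrow>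
        msupp (\<mu> t) \<subseteq> msupp (emeasure \<gamma>) \<and> msupp (\<nu> t) \<subseteq> msupp (emeasure \<gamma>)) \<and>
     (\<integral>\<^sup>+ t\<in>{0..1}. action \<phi> (\<mu> t) (\<nu> t) \<gamma> \<partial>lborel) < \<infinity>}"

text \<open>
  The action integrals are finite on \<^const>\<open>CE_action\<close>, so \<^const>\<open>enn2real\<close> is exact; the infimum
  of the empty set is \<open>\<infinity>\<close>.
\<close>

definition W_dist ::
  "real \<Rightarrow> (real \<times> 'a::euclidean_space \<Rightarrow> ennreal) \<Rightarrow> 'a measure \<Rightarrow>
   ('a set \<Rightarrow> real) \<Rightarrow> ('a set \<Rightarrow> real) \<Rightarrow> ennreal" where
  "W_dist p \<phi> \<gamma> \<mu>0 \<mu>1 =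
     (INF (\<mu>, \<nu>) \<in> CE_action \<phi> \<gamma> \<mu>0 \<mu>1.
        ennreal (enn2real (\<integral>\<^sup>+ t\<in>{0..1}. action \<phi> (\<mu> t) (\<nu> t) \<gamma> \<partial>lborel) powr (1 / p)))"


section \<open>Smooth domains and the space of measures\<close>

text \<open>
  Near each boundary point the domain is, in suitable orthonormal coordinates with last axis
  along \<open>e\<close>, the strict subgraph of a \<open>C\<^sup>\<infinity>\<close> function \<open>h\<close> of the component orthogonal to \<open>e\<close>.
\<close>

definition smooth_domain :: "'a::euclidean_space set \<Rightarrow> bool" where
  "smooth_domain \<Omega> \<longleftrightarrow> open \<Omega> \<and> connected \<Omega> \<and> \<Omega> \<noteq> {} \<and>
     (\<forall>x\<in>frontier \<Omega>. \<exists>r>0. \<exists>e. norm e = 1 \<and> (\<exists>h. (\<forall>k. Ck k h) \<and>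
        \<Omega> \<inter> ball x r = {y \<in> ball x r. y \<bullet> e < h (y - (y \<bullet> e) *\<^sub>R e)}))"

definition gamma_dom :: "'a::euclidean_space set \<Rightarrow> 'a measure" where
  "gamma_dom \<Omega> = density lborel (indicator \<Omega>)"

definition M_space :: "real \<Rightarrow> real \<Rightarrow> real \<Rightarrow> 'a::euclidean_space set \<Rightarrow> ('a set \<Rightarrow> real) set" where
  "M_space a b c \<Omega> = {\<mu>. radon \<mu> \<and> msupp \<mu> \<subseteq> closure \<Omega> \<and>
     (\<exists>\<rho>. loc_integrable (gamma_dom \<Omega>) \<rho> \<and> \<mu> = with_density \<rho> (gamma_dom \<Omega>) \<and>
          (AE x in gamma_dom \<Omega>. a \<le> \<rho> x \<and> \<rho> x \<le> b)) \<and>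
     \<mu> (closure \<Omega>) = c}"

end

theory Submission
  imports Defs
begin

text \<open>
  Let \<open>m = c / |\<Omega>| \<in> (a, b)\<close>, let \<open>\<mu>\<^sub>i = \<rho>\<^sub>i\<gamma>\<close>, and choose bounded fields \<open>w\<^sub>i\<close> on \<open>\<Omega>\<close> with zero normal flux and
  \<open>- div w\<^sub>i = \<rho>\<^sub>i - m\<close>. For every angle \<open>\<theta> = \<pi>t/2\<close> the density
  \<open>m + cos\<^sup>4\<theta> (\<rho>\<^sub>0 - m) + sin\<^sup>4\<theta> (\<rho>\<^sub>1 - m)\<close> contains the fraction \<open>1 - cos\<^sup>4\<theta> - sin\<^sup>4\<theta> = 2 sin\<^sup>2\<theta> cos\<^sup>2\<theta>\<close>
  of the interior value \<open>m\<close>, so convexity and 2-homogeneity bound \<open>\<phi>\<close> there by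
  \<open>\<phi>(m, \<cdot>) / (sin\<^sup>2\<theta> cos\<^sup>2\<theta>)\<close>. The velocity of the path carries a factor \<open>sin \<theta> cos \<theta>\<close>, whose square
  cancels the denominator. The action is therefore bounded along the path, uniformly in \<open>\<mu>\<^sub>0\<close>, \<open>\<mu>\<^sub>1\<close>.
\<close>

section \<open>Measures with a bounded density on a bounded set\<close>

text \<open>The obstacle is the boundary of the domain of \<open>\<phi>\<close>: the given densities
  may equal \<open>a\<close> or \<open>b\<close> on sets of positive measure, where no finite bound
  for a nonzero momentum is available, so straight interpolation may have infinite action. The
  strict bounds on \<open>c\<close> put the mean density in the open interval, where
  \<open>\<phi>\<close> is finite for every momentum. Moving towards the mean at constant speed is
  not enough: near an end of the path the fraction of the mean is of order t, and the estimate of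
  order 1/t is not integrable. The fourth powers slow the motion down there: the fraction is of
  order t^2 and the velocity of order t. Squares of cosine and sine would add up to 1 and leave no
  room for the mean. The convexity estimate spends only half of the available fraction on the
  momentum; the other half keeps the complementary density strictly between \<open>a\<close> and
  \<open>b\<close>. Zero normal flux is encoded by test functions that need not vanish on the
  boundary of the domain; it makes the flux, extended by zero, solve the equation on the whole
  space.\<close>

lemma sets_gamma_dom [simp, measurable_cong]: "sets (gamma_dom S) = sets borel"
  by (simp add: gamma_dom_def)

lemma space_gamma_dom [simp]: "space (gamma_dom S) = UNIV"
  by (simp add: gamma_dom_def)

lemma emeasure_gamma_dom:
  assumes "S \<in> sets borel" "A \<in> sets borel"
  shows "emeasure (gamma_dom S) A = emeasure lborel (S \<inter> A)"
  unfolding gamma_dom_def using assms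
  by (simp add: emeasure_density indicator_inter_arith[symmetric])

lemma AE_gamma_dom:
  assumes "S \<in> sets borel"
  shows "AE x in gamma_dom S. x \<in> S"
  unfolding gamma_dom_def using assms by (subst AE_density) (auto simp: indicator_def)

lemma finite_measure_gamma_dom:
  assumes "S \<in> sets borel" "bounded S"
  shows "finite_measure (gamma_dom S)"
  using emeasure_bounded_finite[of S] assms
  by (intro finite_measureI) (auto simp: emeasure_gamma_dom)

lemma LINT_eq_gamma_dom:
  fixes f :: "'a::euclidean_space \<Rightarrow> real"
  assumes "S \<in> sets borel" "f \<in> borel_measurable borel"
  shows "(LINT x:S|lborel. f x) = (\<integral>x. f x \<partial>gamma_dom S)"
proof -
  have "gamma_dom S = density lborel (\<lambda>x. ennreal (indicator S x))"
    unfolding gamma_dom_def by (simp add: ennreal_indicator)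
  then show ?thesis
    unfolding set_lebesgue_integral_def using assms by (simp add: integral_density)
qed

lemma with_density_null_set:
  fixes g :: "'a::euclidean_space \<Rightarrow> 'b::euclidean_space"
  assumes "sets M = sets borel" "B \<in> sets borel" "emeasure M B = 0"
  shows "with_density g M B = 0"
proof -
  have "AE x in M. x \<notin> B"
    using assms by (intro AE_not_in) auto
  then have "AE x in M. indicator B x *\<^sub>R g x = 0"
    by (auto simp: indicator_def)
  then show ?thesis
    by (auto simp: with_density_def set_lebesgue_integral_def integral_eq_zero_AE)
qed

locale bounded_borel_set =
  fixes S :: "'a::euclidean_space set"
  assumes borel_S [measurable]: "S \<in> sets borel" and bounded_S: "bounded S"
begin

sublocale gam: finite_measure "gamma_dom S"
  by (rule finite_measure_gamma_dom[OF borel_S bounded_S])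

text \<open>\<open>gamma_dom S\<close> lives on the bounded set \<open>S\<close>, so a Borel set can
  be cut down to \<open>S\<close> at no cost. The smaller set is in \<open>bounded_borel\<close>,
  outside of which \<open>with_density\<close> is 0 by convention.\<close>

lemma set_integral_Int_S:
  fixes g :: "'a \<Rightarrow> 'b::euclidean_space"
  assumes "g \<in> borel_measurable borel" "A \<in> sets borel"
  shows "set_lebesgue_integral (gamma_dom S) (A \<inter> S) g = set_lebesgue_integral (gamma_dom S) A g"
  unfolding set_lebesgue_integral_def using assms AE_gamma_dom[OF borel_S]
  by (intro integral_cong_AE) (auto simp: indicator_def)

lemma Int_bounded_borel: "A \<in> sets borel \<Longrightarrow> A \<inter> S \<in> bounded_borel"
  unfolding bounded_borel_def using bounded_S by (auto intro: bounded_subset)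

lemma integrable_bounded:
  fixes g :: "'a \<Rightarrow> 'b::euclidean_space"
  assumes "g \<in> borel_measurable borel" "\<And>x. norm (g x) \<le> K"
  shows "integrable (gamma_dom S) g"
  using assms by (intro gam.integrable_const_bound[of _ K]) auto

lemma set_integrable_sub:
  fixes g :: "'a \<Rightarrow> 'b::euclidean_space"
  assumes "integrable (gamma_dom S) g" "A \<in> sets borel"
  shows "set_integrable (gamma_dom S) A g"
  unfolding set_integrable_def using assms by (intro integrable_mult_indicator) auto

lemma loc_integrable_bounded:
  fixes g :: "'a \<Rightarrow> 'b::euclidean_space"
  assumes "g \<in> borel_measurable borel" "\<And>x. norm (g x) \<le> K"
  shows "loc_integrable (gamma_dom S) g"
  unfolding loc_integrable_def bounded_borel_def
  using set_integrable_sub[OF integrable_bounded[OF assms]] assms by auto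

lemma integrable_if_loc_integrable:
  fixes g :: "'a \<Rightarrow> 'b::euclidean_space"
  assumes "loc_integrable (gamma_dom S) g"
  shows "integrable (gamma_dom S) g"
proof -
  have [measurable]: "g \<in> borel_measurable borel" and "set_integrable (gamma_dom S) S g"
    using assms borel_S bounded_S unfolding loc_integrable_def bounded_borel_def by auto
  then have "integrable (gamma_dom S) (\<lambda>x. indicator S x *\<^sub>R g x)"
    by (simp add: set_integrable_def)
  moreover have "AE x in gamma_dom S. indicator S x *\<^sub>R g x = g x"
    using AE_gamma_dom[OF borel_S] by (auto simp: indicator_def)
  ultimately show ?thesis
    by (subst integrable_cong_AE[where g="\<lambda>x. indicator S x *\<^sub>R g x"]) (auto elim: eventually_mono)
qed

lemma radon_with_density:
  fixes g :: "'a \<Rightarrow> 'b::euclidean_space"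
  assumes "integrable (gamma_dom S) g"
  shows "radon (with_density g (gamma_dom S))"
  unfolding radon_def
proof (intro conjI allI impI)
  fix A :: "nat \<Rightarrow> 'a set"
  assume A: "range A \<subseteq> bounded_borel \<and> disjoint_family A \<and> bounded (\<Union>n. A n)"
  then have [measurable]: "\<And>n. A n \<in> sets borel"
    by (auto simp: bounded_borel_def)
  have U: "(\<Union>n. A n) \<in> bounded_borel"
    using A by (auto simp: bounded_borel_def)
  let ?f = "\<lambda>n x. indicator (A n) x *\<^sub>R g x"
  have pt: "(\<lambda>n. indicator (A n) x *\<^sub>R g x) sums (indicator (\<Union>n. A n) x *\<^sub>R g x)" for x
    using A by (intro sums_scaleR_left indicator_sums) (auto simp: disjoint_family_on_def)
  have ptn: "(\<lambda>n. indicator (A n) x * norm (g x)) sums (indicator (\<Union>n. A n) x * norm (g x))" for x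
    using A by (intro sums_mult2 indicator_sums) (auto simp: disjoint_family_on_def)
  have int: "integrable (gamma_dom S) (?f n)" for n
    using assms by (intro integrable_mult_indicator) auto
  \<comment> \<open>Since the \<open>A n\<close> are disjoint, the partial sums of the norms stay
    below \<open>norm (g x)\<close> at every point. This is the domination that allows sum and
    integral to be exchanged.\<close>
  have "summable (\<lambda>n. \<integral>x. norm (?f n x) \<partial>gamma_dom S)"
  proof (rule bounded_imp_summable)
    show "0 \<le> (\<integral>x. norm (?f n x) \<partial>gamma_dom S)" for n by simp
    fix n
    have "(\<Sum>k\<le>n. \<integral>x. norm (?f k x) \<partial>gamma_dom S) = (\<integral>x. (\<Sum>k\<le>n. norm (?f k x)) \<partial>gamma_dom S)"
      using integrable_norm[OF int] by (subst Bochner_Integration.integral_sum) auto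
    also have "\<dots> \<le> (\<integral>x. norm (g x) \<partial>gamma_dom S)"
    proof (rule integral_mono)
      show "integrable (gamma_dom S) (\<lambda>x. \<Sum>k\<le>n. norm (?f k x))"
        by (intro Bochner_Integration.integrable_sum integrable_norm int)
      show "integrable (gamma_dom S) (\<lambda>x. norm (g x))" using assms by auto
      fix x
      have "(\<Sum>k\<le>n. norm (?f k x)) = (\<Sum>k\<le>n. indicator (A k) x * norm (g x))" by simp
      also have "\<dots> \<le> (\<Sum>k. indicator (A k) x * norm (g x))"
        using ptn[of x] by (intro sum_le_suminf) (auto simp: sums_iff)
      also have "\<dots> = indicator (\<Union>n. A n) x * norm (g x)"
        using ptn[of x] by (simp add: sums_iff)
      also have "\<dots> \<le> norm (g x)" by (auto simp: indicator_def)
      finally show "(\<Sum>k\<le>n. norm (?f k x)) \<le> norm (g x)" .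
    qed
    finally show "(\<Sum>k\<le>n. \<integral>x. norm (?f k x) \<partial>gamma_dom S) \<le> (\<integral>x. norm (g x) \<partial>gamma_dom S)" .
  qed
  moreover have "summable (\<lambda>n. norm (?f n x))" for x
    using ptn[of x] by (auto simp: sums_iff)
  ultimately have "(\<lambda>n. integral\<^sup>L (gamma_dom S) (?f n)) sums (\<integral>x. (\<Sum>n. ?f n x) \<partial>gamma_dom S)"
    using int by (intro sums_integral) auto
  moreover have "(\<Sum>n. ?f n x) = indicator (\<Union>n. A n) x *\<^sub>R g x" for x
    using pt[of x] by (simp add: sums_iff)
  ultimately show "(\<lambda>n. with_density g (gamma_dom S) (A n)) sums with_density g (gamma_dom S) (\<Union>n. A n)"
    using A U unfolding with_density_def set_lebesgue_integral_def
    by (auto simp: image_subset_iff)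
qed (simp add: with_density_def)

text \<open>For a measure with a density the Hahn decomposition is explicit: the supremum in
  \<open>jordan_pos\<close> is attained on the part of the set where \<open>g\<close> is
  non-negative.\<close>

lemma jordan_pos_with_density:
  assumes g: "integrable (gamma_dom S) g"
  shows "jordan_pos (with_density g (gamma_dom S)) = density (gamma_dom S) (\<lambda>x. ennreal (g x))"
proof -
  have [measurable]: "g \<in> borel_measurable borel" using g by (auto dest: borel_measurable_integrable)
  let ?D = "density (gamma_dom S) (\<lambda>x. ennreal (g x))"
  have gm: "integrable (gamma_dom S) (\<lambda>x. max 0 (g x))" using g by auto
  have emD: "emeasure ?D B = ennreal (set_lebesgue_integral (gamma_dom S) B (\<lambda>x. max 0 (g x)))"
    if [measurable]: "B \<in> sets borel" for B
  proof -
    have "emeasure ?D B = (\<integral>\<^sup>+ x. ennreal (indicator B x *\<^sub>R max 0 (g x)) \<partial>gamma_dom S)"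
      by (subst emeasure_density) (auto intro!: nn_integral_cong simp: indicator_def max_def ennreal_neg)
    also have "\<dots> = ennreal (\<integral>x. indicator B x *\<^sub>R max 0 (g x) \<partial>gamma_dom S)"
      using set_integrable_sub[OF gm that] unfolding set_integrable_def
      by (intro nn_integral_eq_integral) (auto simp: indicator_def)
    finally show ?thesis by (simp add: set_lebesgue_integral_def)
  qed
  have "(SUP A \<in> {A \<in> sets borel. A \<subseteq> B}. ennreal (with_density g (gamma_dom S) A)) = emeasure ?D B"
    if B[measurable]: "B \<in> sets borel" for B
  proof (rule antisym)
    show "(SUP A \<in> {A \<in> sets borel. A \<subseteq> B}. ennreal (with_density g (gamma_dom S) A)) \<le> emeasure ?D B"
    proof (rule SUP_least)
      fix A assume "A \<in> {A \<in> sets borel. A \<subseteq> B}"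
      then have A[measurable]: "A \<in> sets borel" and "A \<subseteq> B" by auto
      have "with_density g (gamma_dom S) A \<le> set_lebesgue_integral (gamma_dom S) A (\<lambda>x. max 0 (g x))"
        unfolding with_density_def
        using set_integral_mono[OF set_integrable_sub[OF g A] set_integrable_sub[OF gm A]]
        by (auto simp: set_lebesgue_integral_def intro!: integral_nonneg)
      then have "ennreal (with_density g (gamma_dom S) A) \<le> emeasure ?D A"
        by (simp add: emD ennreal_leI)
      also have "\<dots> \<le> emeasure ?D B"
        using \<open>A \<subseteq> B\<close> by (intro emeasure_mono) auto
      finally show "ennreal (with_density g (gamma_dom S) A) \<le> emeasure ?D B" .
    qed
  next
    \<comment> \<open>The intersection with \<open>S\<close> makes the maximizing set bounded; on an
      unbounded set the value of \<open>with_density\<close> would be 0 instead of the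
      integral.\<close>
    let ?A = "(B \<inter> {x. 0 \<le> g x}) \<inter> S"
    have "set_lebesgue_integral (gamma_dom S) (B \<inter> S) (\<lambda>x. max 0 (g x)) = set_lebesgue_integral (gamma_dom S) ?A g"
      unfolding set_lebesgue_integral_def by (intro Bochner_Integration.integral_cong) (auto simp: indicator_def)
    also have "\<dots> = with_density g (gamma_dom S) ?A"
      unfolding with_density_def by (subst if_P) (auto intro!: Int_bounded_borel)
    finally have "emeasure ?D B = ennreal (with_density g (gamma_dom S) ?A)"
      using set_integral_Int_S[of "\<lambda>x. max 0 (g x)" B] by (simp add: emD)
    then show "emeasure ?D B \<le> (SUP A \<in> {A \<in> sets borel. A \<subseteq> B}. ennreal (with_density g (gamma_dom S) A))"
      by (auto intro!: SUP_upper)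
  qed
  then have "jordan_pos (with_density g (gamma_dom S)) = measure_of UNIV (sets borel) (emeasure ?D)"
    unfolding jordan_pos_def by (intro measure_of_eq) (auto simp: sets.sigma_sets_eq[of borel, simplified])
  also have "\<dots> = ?D"
    using measure_of_of_measure[of ?D] by simp
  finally show ?thesis .
qed

lemma signed_integral_with_density:
  assumes g: "integrable (gamma_dom S) g"
    and f [measurable]: "f \<in> borel_measurable borel" "\<And>x. \<bar>f x\<bar> \<le> K"
  shows "signed_integral (with_density g (gamma_dom S)) f = (\<integral>x. f x * g x \<partial>gamma_dom S)"
proof -
  have [measurable]: "g \<in> borel_measurable borel" using g by (auto dest: borel_measurable_integrable)
  have neg: "(\<lambda>B. - with_density g (gamma_dom S) B) = with_density (\<lambda>x. - g x) (gamma_dom S)"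
    using g by (auto simp: with_density_def set_lebesgue_integral_def fun_eq_iff)
  have int: "integrable (gamma_dom S) (\<lambda>x. f x * h x)" if "integrable (gamma_dom S) h" for h
  proof (rule Bochner_Integration.integrable_bound[where f="\<lambda>x. K * h x"])
    show "integrable (gamma_dom S) (\<lambda>x. K * h x)" using that by auto
    show "AE x in gamma_dom S. norm (f x * h x) \<le> norm (K * h x)"
      using order_trans[OF f(2) abs_ge_self] by (auto simp: abs_mult intro!: AE_I2 mult_right_mono)
  qed (use that in \<open>auto dest: borel_measurable_integrable\<close>)
  have pos: "(\<integral>x. f x \<partial>density (gamma_dom S) (\<lambda>x. ennreal (h x))) = (\<integral>x. f x * max 0 (h x) \<partial>gamma_dom S)"
    if [measurable]: "h \<in> borel_measurable borel" for h
  proof -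
    have "density (gamma_dom S) (\<lambda>x. ennreal (h x)) = density (gamma_dom S) (\<lambda>x. ennreal (max 0 (h x)))"
      by (intro density_cong) (auto simp: max_def ennreal_neg)
    then show ?thesis
      by (simp add: integral_density mult.commute)
  qed
  have "signed_integral (with_density g (gamma_dom S)) f
      = (\<integral>x. f x * max 0 (g x) \<partial>gamma_dom S) - (\<integral>x. f x * max 0 (- g x) \<partial>gamma_dom S)"
    unfolding signed_integral_def neg using g by (simp add: jordan_pos_with_density pos)
  also have "\<dots> = (\<integral>x. f x * max 0 (g x) - f x * max 0 (- g x) \<partial>gamma_dom S)"
    using g by (intro Bochner_Integration.integral_diff[symmetric] int) auto
  also have "\<dots> = (\<integral>x. f x * g x \<partial>gamma_dom S)"
    by (intro Bochner_Integration.integral_cong) (auto simp: max_def)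
  finally show ?thesis .
qed

lemma with_density_inner:
  assumes "integrable (gamma_dom S) w"
  shows "(\<lambda>B. with_density w (gamma_dom S) B \<bullet> i) = with_density (\<lambda>x. w x \<bullet> i) (gamma_dom S)"
proof
  fix B
  have "B \<in> sets borel \<Longrightarrow> integrable (gamma_dom S) (\<lambda>x. indicator B x *\<^sub>R w x)"
    using assms by (intro integrable_mult_indicator) auto
  then show "with_density w (gamma_dom S) B \<bullet> i = with_density (\<lambda>x. w x \<bullet> i) (gamma_dom S) B"
    by (auto simp: with_density_def set_lebesgue_integral_def bounded_borel_def
        simp flip: integral_inner_left)
qed

lemma vector_integral_with_density:
  assumes w: "integrable (gamma_dom S) w"
    and G [measurable]: "G \<in> borel_measurable borel" "\<And>x. norm (G x) \<le> K"
  shows "vector_integral (with_density w (gamma_dom S)) G = (\<integral>x. G x \<bullet> w x \<partial>gamma_dom S)"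
proof -
  have [measurable]: "w \<in> borel_measurable borel" using w by (auto dest: borel_measurable_integrable)
  have wi: "integrable (gamma_dom S) (\<lambda>x. w x \<bullet> i)" for i using w by auto
  have Gi: "\<bar>G x \<bullet> i\<bar> \<le> K" if "i \<in> Basis" for x i
    using G(2)[of x] Basis_le_norm[OF that, of "G x"] by linarith
  have "integrable (gamma_dom S) (\<lambda>x. (G x \<bullet> i) * (w x \<bullet> i))" if "i \<in> Basis" for i
  proof (rule Bochner_Integration.integrable_bound[where f="\<lambda>x. K * (w x \<bullet> i)"])
    show "AE x in gamma_dom S. norm ((G x \<bullet> i) * (w x \<bullet> i)) \<le> norm (K * (w x \<bullet> i))"
      using order_trans[OF Gi[OF that] abs_ge_self] by (auto simp: abs_mult intro!: AE_I2 mult_right_mono)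
  qed (use w in auto)
  then have "(\<integral>x. G x \<bullet> w x \<partial>gamma_dom S) = (\<Sum>i\<in>Basis. \<integral>x. (G x \<bullet> i) * (w x \<bullet> i) \<partial>gamma_dom S)"
    by (subst euclidean_inner, subst Bochner_Integration.integral_sum) auto
  then show ?thesis
    unfolding vector_integral_def with_density_inner[OF w]
    by (auto intro!: sum.cong signed_integral_with_density[OF wi _ Gi])
qed

lemma total_variation_with_density:
  fixes g :: "'a \<Rightarrow> 'b::euclidean_space"
  assumes [measurable]: "g \<in> borel_measurable borel" and K: "\<And>x. norm (g x) \<le> K"
  shows "total_variation (with_density g (gamma_dom S)) B \<le> ennreal (K * measure (gamma_dom S) UNIV)"
  unfolding total_variation_def
proof (rule SUP_least)
  have K0: "0 \<le> K" using K[of 0] norm_ge_zero order_trans by blast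
  fix P assume "P \<in> {P. finite P \<and> P \<subseteq> sets borel \<and> disjoint P \<and> \<Union>P \<subseteq> B}"
  then have P: "finite P" "P \<subseteq> sets borel" "disjoint P" by auto
  have *: "norm (with_density g (gamma_dom S) A) \<le> K * measure (gamma_dom S) A" if "A \<in> P" for A
  proof -
    have [measurable]: "A \<in> sets borel" using that P by auto
    have "norm (set_lebesgue_integral (gamma_dom S) A g) \<le> (\<integral>x. K * indicator A x \<partial>gamma_dom S)"
      unfolding set_lebesgue_integral_def
    proof (rule order_trans[OF integral_norm_bound], rule integral_mono)
      show "integrable (gamma_dom S) (\<lambda>x. norm (indicat_real A x *\<^sub>R g x))"
        using set_integrable_sub[OF integrable_bounded[OF assms], of A]
        unfolding set_integrable_def by (intro integrable_norm) auto
      show "integrable (gamma_dom S) (\<lambda>x. K * indicat_real A x)"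
        by (auto simp: gam.emeasure_finite less_top[symmetric])
    qed (use K in \<open>auto simp: indicator_def\<close>)
    also have "\<dots> = K * measure (gamma_dom S) A" by simp
    finally show ?thesis using K0 by (auto simp: with_density_def)
  qed
  have "(\<Sum>A\<in>P. ennreal (norm (with_density g (gamma_dom S) A))) = ennreal (\<Sum>A\<in>P. norm (with_density g (gamma_dom S) A))"
    by (simp add: sum_ennreal)
  also have "\<dots> \<le> ennreal (\<Sum>A\<in>P. K * measure (gamma_dom S) A)"
    by (intro ennreal_leI sum_mono *)
  also have "(\<Sum>A\<in>P. K * measure (gamma_dom S) A) = K * measure (gamma_dom S) (\<Union>P)"
    using P by (subst gam.finite_measure_finite_Union[of P "\<lambda>x. x", simplified])
      (auto simp: sum_distrib_left disjoint_def disjoint_family_on_def)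
  also have "ennreal \<dots> \<le> ennreal (K * measure (gamma_dom S) UNIV)"
    using K0 P by (intro ennreal_leI mult_left_mono gam.finite_measure_mono) auto
  finally show "(\<Sum>A\<in>P. ennreal (norm (with_density g (gamma_dom S) A))) \<le> ennreal (K * measure (gamma_dom S) UNIV)" .
qed

lemma msupp_with_density:
  fixes g :: "'a \<Rightarrow> 'b::euclidean_space"
  shows "msupp (with_density g (gamma_dom S)) \<subseteq> msupp (emeasure (gamma_dom S))"
  unfolding msupp_def using with_density_null_set[of "gamma_dom S" _ g] by auto blast

end

section \<open>The action of absolutely continuous measures\<close>

lemma sigma_finite_pos_radon:
  assumes "pos_radon \<sigma>"
  shows "sigma_finite_measure \<sigma>"
proof
  have s: "sets \<sigma> = sets borel" and K: "\<And>K. compact K \<Longrightarrow> emeasure \<sigma> K < \<infinity>"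
    using assms by (auto simp: pos_radon_def)
  have "space \<sigma> = UNIV" using sets_eq_imp_space_eq[OF s] by simp
  moreover have "\<exists>n. norm x \<le> real n" for x :: 'a by (rule real_arch_simple)
  ultimately have "(\<Union>n. cball 0 (real n)) = space \<sigma>" by auto
  moreover have "emeasure \<sigma> (cball 0 (real n)) \<noteq> \<infinity>" for n
    using K[OF compact_cball, of 0 "real n"] by simp
  ultimately show "\<exists>A. countable A \<and> A \<subseteq> sets \<sigma> \<and> \<Union>A = space \<sigma> \<and> (\<forall>a\<in>A. emeasure \<sigma> a \<noteq> \<infinity>)"
    by (intro exI[of _ "range (\<lambda>n. cball 0 (real n))"]) (auto simp: s)
qed

text \<open>Needed because a decomposition picked by \<open>SOME\<close> may come with a nonzero
  \<open>\<sigma>\<close> whose densities vanish. The supremum runs over points where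
  \<open>\<phi>\<close> is finite, so each difference is a genuine 0 and not infinity minus
  infinity.\<close>

lemma recession_zero:
  assumes "edom \<phi> \<noteq> {}"
  shows "recession \<phi> 0 = 0"
proof -
  have "enn2ereal (\<phi> x) - enn2ereal (\<phi> x) = 0" if "x \<in> edom \<phi>" for x
    using that unfolding edom_def by (cases "\<phi> x") (auto simp: zero_ereal_def)
  then have "(\<lambda>x. enn2ereal (\<phi> (x + 0)) - enn2ereal (\<phi> x)) ` edom \<phi> = {0}"
    using assms by (auto simp: image_iff)
  then show ?thesis unfolding recession_def by simp
qed

context bounded_borel_set
begin

text \<open>Mutual singularity gives a set \<open>N\<close> that is null for one measure and has a
  null complement for the other. Evaluating \<open>eq\<close> off \<open>N\<close> isolates the part
  carried by \<open>gamma_dom S\<close>, and evaluating it inside \<open>N\<close> isolates the part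
  carried by \<open>\<sigma>\<close>.\<close>

lemma with_density_decomp_unique:
  fixes u u' us :: "'a \<Rightarrow> 'b::euclidean_space"
  assumes u: "integrable (gamma_dom S) u" and u': "loc_integrable (gamma_dom S) u'"
    and \<sigma>: "pos_radon \<sigma>" "mutually_singular \<sigma> (gamma_dom S)" and us: "loc_integrable \<sigma> us"
    and eq: "with_density u (gamma_dom S)
      = (\<lambda>B. with_density u' (gamma_dom S) B + with_density us \<sigma> B)"
  shows "AE x in gamma_dom S. u x = u' x" "AE x in \<sigma>. us x = 0"
proof -
  obtain N where N[measurable]: "N \<in> sets borel" and gN: "emeasure (gamma_dom S) N = 0"
    and sN: "emeasure \<sigma> (- N) = 0"
    using \<sigma>(2) unfolding mutually_singular_def by auto
  have s\<sigma> [measurable_cong]: "sets \<sigma> = sets borel" using \<sigma> by (auto simp: pos_radon_def)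
  have u'i: "integrable (gamma_dom S) u'" by (rule integrable_if_loc_integrable[OF u'])
  have [measurable]: "u \<in> borel_measurable borel" "u' \<in> borel_measurable borel" "us \<in> borel_measurable borel"
    using u u' us by (auto dest: borel_measurable_integrable simp: loc_integrable_def)
  have gN': "AE x in gamma_dom S. x \<notin> N" using gN by (intro AE_not_in) auto
  have sN': "AE x in \<sigma>. x \<notin> - N" using sN by (intro AE_not_in) auto
  show "AE x in gamma_dom S. u x = u' x"
  proof (rule gam.density_unique_banach[OF u u'i])
    fix A assume "A \<in> sets (gamma_dom S)"
    then have [measurable]: "A \<in> sets borel" by simp
    \<comment> \<open>Removing \<open>N\<close> does not change integrals against
      \<open>gamma_dom S\<close> and leaves a set that is null for \<open>\<sigma>\<close>;
      intersecting with \<open>S\<close> makes it a set on which \<open>eq\<close> has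
      content.\<close>
    let ?B = "(A - N) \<inter> S"
    have B: "?B \<in> bounded_borel" by (intro Int_bounded_borel) auto
    have sB: "emeasure \<sigma> ?B = 0"
      by (rule emeasure_eq_0[OF _ sN]) auto
    have AB: "set_lebesgue_integral (gamma_dom S) A h = with_density h (gamma_dom S) ?B"
      if [measurable]: "h \<in> borel_measurable borel" for h :: "'a \<Rightarrow> 'b"
    proof -
      have "set_lebesgue_integral (gamma_dom S) A h = set_lebesgue_integral (gamma_dom S) ?B h"
        unfolding set_lebesgue_integral_def using gN' AE_gamma_dom[OF borel_S]
        by (intro integral_cong_AE) (auto simp: indicator_def)
      then show ?thesis using B by (simp add: with_density_def)
    qed
    have "with_density us \<sigma> ?B = 0"
      by (rule with_density_null_set[OF s\<sigma> _ sB]) auto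
    then show "set_lebesgue_integral (gamma_dom S) A u = set_lebesgue_integral (gamma_dom S) A u'"
      using fun_cong[OF eq, of ?B] by (simp add: AB)
  qed
  interpret \<sigma>: sigma_finite_measure \<sigma> by (rule sigma_finite_pos_radon[OF \<sigma>(1)])
  \<comment> \<open>\<open>us\<close> is only locally integrable and \<open>\<sigma>\<close> may
    have infinite mass, so the argument is run on balls, which exhaust the space.\<close>
  have "AE x in \<sigma>. indicator (ball 0 (real n)) x *\<^sub>R us x = 0" for n
  proof (rule \<sigma>.density_zero)
    have "ball 0 (real n) \<in> bounded_borel" by (auto simp: bounded_borel_def)
    then show "integrable \<sigma> (\<lambda>x. indicator (ball 0 (real n)) x *\<^sub>R us x)"
      using us by (auto simp: loc_integrable_def set_integrable_def)
    fix A assume "A \<in> sets \<sigma>"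
    then have [measurable]: "A \<in> sets borel" by (simp add: s\<sigma>)
    let ?B = "A \<inter> N \<inter> ball 0 (real n)"
    have B: "?B \<in> bounded_borel" by (auto simp: bounded_borel_def)
    have "emeasure (gamma_dom S) ?B = 0"
      by (rule emeasure_eq_0[OF _ gN]) auto
    then have 0: "with_density h (gamma_dom S) ?B = 0" for h :: "'a \<Rightarrow> 'b"
      by (intro with_density_null_set) auto
    have "(\<integral>x\<in>A. indicator (ball 0 (real n)) x *\<^sub>R us x \<partial>\<sigma>) = set_lebesgue_integral \<sigma> ?B us"
      unfolding set_lebesgue_integral_def using sN'
      by (intro integral_cong_AE) (auto simp: indicator_def)
    also have "\<dots> = with_density us \<sigma> ?B" using B by (simp add: with_density_def)
    also have "\<dots> = 0" using fun_cong[OF eq, of ?B] by (simp add: 0)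
    finally show "(\<integral>x\<in>A. indicator (ball 0 (real n)) x *\<^sub>R us x \<partial>\<sigma>) = 0" .
  qed
  then have "AE x in \<sigma>. \<forall>n. indicator (ball 0 (real n)) x *\<^sub>R us x = 0"
    by (subst AE_all_countable) blast
  then show "AE x in \<sigma>. us x = 0"
  proof eventually_elim
    case (elim x)
    obtain n where "norm x < real n" using reals_Archimedean2 by blast
    with elim[rule_format, of n] show ?case by simp
  qed
qed

text \<open>Existence of some decomposition, without which the choice by \<open>SOME\<close> in
  \<open>action\<close> would say nothing.\<close>

lemma lebesgue_decomp_trivial:
  assumes "loc_integrable (gamma_dom S) \<rho>" "loc_integrable (gamma_dom S) w"
  shows "lebesgue_decomp (with_density \<rho> (gamma_dom S)) (with_density w (gamma_dom S)) (gamma_dom S)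
    \<rho> w (null_measure borel) (\<lambda>_. 0) (\<lambda>_. 0)"
  using assms unfolding lebesgue_decomp_def
  by (auto simp: pos_radon_def mutually_singular_def loc_integrable_def set_integrable_def
      with_density_def fun_eq_iff intro!: bexI[of _ "{}"])

text \<open>The value of \<open>action\<close> belongs to an unknown decomposition. By uniqueness
  its densities against \<open>gamma_dom S\<close> agree almost everywhere with the given ones, and
  its singular densities vanish, where the recession function is 0.\<close>

lemma action_with_density:
  assumes \<rho>: "loc_integrable (gamma_dom S) \<rho>" and w: "loc_integrable (gamma_dom S) w"
    and "edom \<phi> \<noteq> {}"
  shows "action \<phi> (with_density \<rho> (gamma_dom S)) (with_density w (gamma_dom S)) (gamma_dom S)
    = (\<integral>\<^sup>+ x. \<phi> (\<rho> x, w x) \<partial>gamma_dom S)"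
proof -
  let ?\<mu> = "with_density \<rho> (gamma_dom S)" and ?\<nu> = "with_density w (gamma_dom S)"
  let ?P = "\<lambda>r. \<exists>\<rho>' w' \<sigma> \<rho>s ws. lebesgue_decomp ?\<mu> ?\<nu> (gamma_dom S) \<rho>' w' \<sigma> \<rho>s ws \<and>
        r = (\<integral>\<^sup>+ x. \<phi> (\<rho>' x, w' x) \<partial>gamma_dom S) + (\<integral>\<^sup>+ x. e2ennreal (recession \<phi> (\<rho>s x, ws x)) \<partial>\<sigma>)"
  have "\<exists>r. ?P r"
    using lebesgue_decomp_trivial[OF \<rho> w] by blast
  then have "?P (action \<phi> ?\<mu> ?\<nu> (gamma_dom S))"
    unfolding action_def by (rule someI_ex)
  then obtain \<rho>' w' \<sigma> \<rho>s ws where d: "lebesgue_decomp ?\<mu> ?\<nu> (gamma_dom S) \<rho>' w' \<sigma> \<rho>s ws"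
    and r: "action \<phi> ?\<mu> ?\<nu> (gamma_dom S) =
      (\<integral>\<^sup>+ x. \<phi> (\<rho>' x, w' x) \<partial>gamma_dom S) + (\<integral>\<^sup>+ x. e2ennreal (recession \<phi> (\<rho>s x, ws x)) \<partial>\<sigma>)"
    by blast
  note d = d[unfolded lebesgue_decomp_def]
  have \<sigma>: "pos_radon \<sigma>" "mutually_singular \<sigma> (gamma_dom S)" using d by auto
  have "AE x in gamma_dom S. \<rho> x = \<rho>' x" "AE x in \<sigma>. \<rho>s x = 0"
    using with_density_decomp_unique[OF integrable_if_loc_integrable[OF \<rho>] _ \<sigma>, of \<rho>' \<rho>s] d by auto
  moreover have "AE x in gamma_dom S. w x = w' x" "AE x in \<sigma>. ws x = 0"
    using with_density_decomp_unique[OF integrable_if_loc_integrable[OF w] _ \<sigma>, of w' ws] d by auto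
  ultimately have 1: "AE x in gamma_dom S. \<phi> (\<rho>' x, w' x) = \<phi> (\<rho> x, w x)"
    and 2: "AE x in \<sigma>. e2ennreal (recession \<phi> (\<rho>s x, ws x)) = 0"
    using recession_zero[OF assms(3)] by (auto simp: zero_prod_def e2ennreal_neg)
  show ?thesis
    unfolding r using nn_integral_cong_AE[OF 1] nn_integral_cong_AE[OF 2] by simp
qed

end

section \<open>Estimates for admissible densities from convexity and homogeneity\<close>

lemma admissible_on_interior:
  assumes "\<phi> \<in> admissible_on p a b" "r \<in> {a<..<b}"
  shows "(r, w) \<in> edom \<phi>"
  using assms interior_subset[of "edom \<phi>"] unfolding admissible_on_def by auto

lemma admissible_on_homogeneous:
  assumes "\<phi> \<in> admissible_on p a b" "r \<in> {a<..<b}"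
  shows "\<phi> (r, 0) = 0" "l \<noteq> 0 \<Longrightarrow> \<phi> (r, l *\<^sub>R w) = ennreal (\<bar>l\<bar> powr p) * \<phi> (r, w)"
proof -
  have "(r, 0) \<in> edom \<phi>" by (rule admissible_on_interior[OF assms])
  then have "({r} \<times> UNIV) \<inter> edom \<phi> \<noteq> {}" by auto
  then show "\<phi> (r, 0) = 0" "l \<noteq> 0 \<Longrightarrow> \<phi> (r, l *\<^sub>R w) = ennreal (\<bar>l\<bar> powr p) * \<phi> (r, w)"
    using assms(1) unfolding admissible_on_def admissible_def by blast+
qed

lemma admissible_on_econvex: "\<phi> \<in> admissible_on p a b \<Longrightarrow> econvex \<phi>"
  by (simp add: admissible_on_def admissible_def)

text \<open>All momentum is loaded onto the point \<open>m\<close>: the argument is the convex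
  combination of \<open>(r, 0)\<close> and \<open>(m, w / u)\<close>. The first point costs nothing,
  and the second costs \<open>u\<close> times the factor \<open>1 / u^2\<close> from
  homogeneity.\<close>

lemma admissible_on_interpolate:
  assumes \<phi>: "\<phi> \<in> admissible_on 2 a b" and r: "r \<in> {a<..<b}" and m: "m \<in> {a<..<b}"
    and u: "0 < u" "u \<le> 1"
  shows "\<phi> ((1 - u) * r + u * m, w) \<le> ennreal (1 / u) * \<phi> (m, w)"
proof -
  have "\<phi> ((1 - u) *\<^sub>R (r, 0) + u *\<^sub>R (m, (1 / u) *\<^sub>R w))
      \<le> ennreal (1 - u) * \<phi> (r, 0) + ennreal u * \<phi> (m, (1 / u) *\<^sub>R w)"
    by (rule admissible_on_econvex[OF \<phi>, unfolded econvex_def, THEN spec, THEN spec, THEN bspec])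
      (use u in auto)
  also have "\<dots> = ennreal u * (ennreal ((1 / u)\<^sup>2) * \<phi> (m, w))"
    using u admissible_on_homogeneous(1)[OF \<phi> r] admissible_on_homogeneous(2)[OF \<phi> m, of "1 / u" w]
    by (simp add: powr_numeral power_divide)
  also have "\<dots> = ennreal (1 / u) * \<phi> (m, w)"
    using u by (simp add: mult.assoc[symmetric] ennreal_mult'[symmetric] power2_eq_square)
  finally show ?thesis using u by simp
qed

lemma econvex_le_max:
  assumes "econvex \<phi>" "u \<in> {0..1}"
  shows "\<phi> ((1 - u) *\<^sub>R x + u *\<^sub>R y) \<le> max (\<phi> x) (\<phi> y)"
proof -
  have "\<phi> ((1 - u) *\<^sub>R x + u *\<^sub>R y) \<le> ennreal (1 - u) * \<phi> x + ennreal u * \<phi> y"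
    using assms unfolding econvex_def by auto
  also have "\<dots> \<le> ennreal (1 - u) * max (\<phi> x) (\<phi> y) + ennreal u * max (\<phi> x) (\<phi> y)"
    by (intro add_mono mult_left_mono) auto
  also have "\<dots> = (ennreal (1 - u) + ennreal u) * max (\<phi> x) (\<phi> y)"
    by (simp add: distrib_right)
  also have "ennreal (1 - u) + ennreal u = 1"
    using assms(2) by (simp flip: ennreal_plus)
  finally show ?thesis by simp
qed

text \<open>A convex function is bounded on a polytope by its values at the vertices. The ball is
  enclosed in a box, the hull of finitely many points, and \<open>\<phi> (m, _)\<close> is finite at
  each of them.\<close>

lemma admissible_on_bounded_ball:
  fixes \<phi> :: "real \<times> 'a::euclidean_space \<Rightarrow> ennreal"
  assumes \<phi>: "\<phi> \<in> admissible_on p a b" and m: "m \<in> {a<..<b}"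
  obtains K where "0 \<le> K" "\<And>w. norm w \<le> R \<Longrightarrow> \<phi> (m, w) \<le> ennreal K"
proof -
  obtain c d where cb: "cball (0::'a) R \<subseteq> cbox c d"
    by (metis bounded_cball bounded_subset_cbox_symmetric)
  obtain V where V: "finite V" "cbox c d = convex hull V"
    using closed_interval_as_convex_hull by metis
  \<comment> \<open>The sum over the vertices stands in for their maximum; it is finite and
    dominates each term.\<close>
  define K where "K = (\<Sum>v\<in>V. \<phi> (m, v))"
  have fin: "\<phi> (m, v) < \<infinity>" for v
    using admissible_on_interior[OF \<phi> m, of v] by (simp add: edom_def)
  then have "K < \<infinity>" using V(1) by (simp add: K_def)
  have "convex {w. \<phi> (m, w) \<le> K}"
    unfolding convex_alt
  proof clarify
    fix x y :: 'a and u :: real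
    assume *: "\<phi> (m, x) \<le> K" "\<phi> (m, y) \<le> K" "0 \<le> u" "u \<le> 1"
    have "\<phi> ((1 - u) *\<^sub>R (m, x) + u *\<^sub>R (m, y)) \<le> max (\<phi> (m, x)) (\<phi> (m, y))"
      using * by (intro econvex_le_max[OF admissible_on_econvex[OF \<phi>]]) auto
    also have "(1 - u) *\<^sub>R (m, x) + u *\<^sub>R (m, y) = (m, (1 - u) *\<^sub>R x + u *\<^sub>R y)"
      by (simp add: algebra_simps)
    finally show "\<phi> (m, (1 - u) *\<^sub>R x + u *\<^sub>R y) \<le> K"
      using * by (auto intro: order_trans)
  qed
  moreover have "V \<subseteq> {w. \<phi> (m, w) \<le> K}"
    unfolding K_def using V(1) by (auto intro!: member_le_sum)
  ultimately have "convex hull V \<subseteq> {w. \<phi> (m, w) \<le> K}"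
    by (rule hull_minimal[rotated])
  then have "\<phi> (m, w) \<le> ennreal (enn2real K)" if "norm w \<le> R" for w
    using that cb V(2) \<open>K < \<infinity>\<close> by auto
  then show ?thesis using that[of "enn2real K"] by simp
qed

section \<open>A bounded right inverse of the divergence\<close>

text \<open>The weight is at most \<open>Q\<close> and preimages have at most \<open>K\<close> times
  the target mass, so the push-forward is at most \<open>Q * K\<close> times \<open>G\<close>.
  Radon-Nikodym then yields a density, which cannot exceed this constant on a set of positive
  measure.\<close>

lemma pushforward_density_nonneg:
  fixes G :: "'a::euclidean_space measure"
  assumes M: "finite_measure M" and G: "finite_measure G" and sG [measurable_cong]: "sets G = sets borel"
    and Z [measurable]: "Z \<in> M \<rightarrow>\<^sub>M borel" and q [measurable]: "q \<in> borel_measurable M"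
    and qQ: "\<And>p. 0 \<le> q p" "\<And>p. q p \<le> Q" and K: "0 \<le> K"
    and dom: "\<And>A. A \<in> sets borel \<Longrightarrow> emeasure M (Z -` A \<inter> space M) \<le> ennreal K * emeasure G A"
  obtains v where "v \<in> borel_measurable borel" "\<And>x. 0 \<le> v x" "\<And>x. v x \<le> Q * K"
    "density G (\<lambda>x. ennreal (v x)) = distr (density M (\<lambda>p. ennreal (q p))) borel Z"
proof -
  interpret M: finite_measure M by fact
  interpret G: finite_measure G by fact
  have [simp]: "space G = UNIV" using sets_eq_imp_space_eq[OF sG] by simp
  have Q: "0 \<le> Q" using qQ order_trans by blast
  define N where "N = distr (density M (\<lambda>p. ennreal (q p))) borel Z"
  have N: "emeasure N A \<le> ennreal (Q * K) * emeasure G A" if [measurable]: "A \<in> sets borel" for A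
  proof -
    have "emeasure N A = (\<integral>\<^sup>+ p. ennreal (q p) * indicator (Z -` A \<inter> space M) p \<partial>M)"
      unfolding N_def by (subst emeasure_distr) (auto simp: emeasure_density)
    also have "\<dots> \<le> (\<integral>\<^sup>+ p. ennreal Q * indicator (Z -` A \<inter> space M) p \<partial>M)"
      using qQ by (intro nn_integral_mono mult_right_mono ennreal_leI) auto
    also have "\<dots> = ennreal Q * emeasure M (Z -` A \<inter> space M)"
      by (subst nn_integral_cmult_indicator) auto
    also have "\<dots> \<le> ennreal Q * (ennreal K * emeasure G A)"
      by (intro mult_left_mono dom) auto
    finally show ?thesis using Q K by (simp add: ennreal_mult mult.assoc)
  qed
  have sN: "sets N = sets borel" by (simp add: N_def)
  have "emeasure N A = 0" if "A \<in> sets borel" "emeasure G A = 0" for A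
    using N[OF that(1)] that(2) by simp
  then have "absolutely_continuous G N"
    unfolding absolutely_continuous_def null_sets_def by (auto simp: sN sG)
  then obtain f where f [measurable]: "f \<in> borel_measurable G" and fN: "density G f = N"
    using G.Radon_Nikodym[of N] by (auto simp: sN sG)
  \<comment> \<open>On the set where the density is too large, the integral of its excess equals the
    difference of the two measures, truncated at 0, and so vanishes by domination.\<close>
  define A where "A = {x. ennreal (Q * K) < f x}"
  have A [measurable]: "A \<in> sets borel" unfolding A_def sG[symmetric]
    by measurable
  have "(\<integral>\<^sup>+ x. f x * indicator A x - ennreal (Q * K) * indicator A x \<partial>G)
      = (\<integral>\<^sup>+ x. f x * indicator A x \<partial>G) - (\<integral>\<^sup>+ x. ennreal (Q * K) * indicator A x \<partial>G)"
  proof (rule nn_integral_diff)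
    show "(\<integral>\<^sup>+ x. ennreal (Q * K) * indicator A x \<partial>G) \<noteq> \<infinity>"
      using G.emeasure_finite[of A] by (subst nn_integral_cmult_indicator) (auto simp: ennreal_mult_eq_top_iff)
    show "AE x in G. ennreal (Q * K) * indicator A x \<le> f x * indicator A x"
      by (auto simp: A_def indicator_def)
  qed auto
  also have "\<dots> = emeasure N A - ennreal (Q * K) * emeasure G A"
    by (subst nn_integral_cmult_indicator) (auto simp: fN[symmetric] emeasure_density)
  also have "\<dots> = 0"
  proof -
    have "ennreal (Q * K) * emeasure G A < top"
      by (simp add: ennreal_mult_eq_top_iff less_top[symmetric])
    with N[OF A] show ?thesis by (auto simp: diff_eq_0_iff_ennreal)
  qed
  finally have "AE x in G. f x * indicator A x - ennreal (Q * K) * indicator A x = 0"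
    by (subst (asm) nn_integral_0_iff_AE) auto
  then have le: "AE x in G. f x \<le> ennreal (Q * K)"
  proof eventually_elim
    case (elim x)
    show ?case
    proof (rule ccontr)
      assume n: "\<not> ?thesis"
      then have "f x - ennreal (Q * K) = 0" using elim by (simp add: A_def)
      then show False using n by (simp add: diff_eq_0_iff_ennreal)
    qed
  qed
  \<comment> \<open>Truncation turns the almost everywhere bound into one at every point and makes
    the values real.\<close>
  define v where "v x = enn2real (min (f x) (ennreal (Q * K)))" for x
  have "density G (\<lambda>x. ennreal (v x)) = density G f"
    using le by (intro density_cong) (auto simp: v_def ennreal_enn2real_if top_unique elim!: eventually_mono)
  moreover have "v x \<le> Q * K" for x
    using Q K unfolding v_def by (intro enn2real_leI) auto
  moreover have "v \<in> borel_measurable borel" unfolding v_def by measurable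
  ultimately show ?thesis using that[of v] fN by (simp add: N_def v_def)
qed

text \<open>Positive and negative part of the weight are pushed forward separately. Both densities
  lie between 0 and \<open>Q * K\<close>, so their difference obeys the same bound without a factor
  2.\<close>

lemma pushforward_density:
  fixes G :: "'a::euclidean_space measure" and q :: "'b \<Rightarrow> real"
  assumes M: "finite_measure M" and G: "finite_measure G" and sG [measurable_cong]: "sets G = sets borel"
    and Z [measurable]: "Z \<in> M \<rightarrow>\<^sub>M borel" and q [measurable]: "q \<in> borel_measurable M"
    and qQ: "\<And>p. \<bar>q p\<bar> \<le> Q" and K: "0 \<le> K"
    and dom: "\<And>A. A \<in> sets borel \<Longrightarrow> emeasure M (Z -` A \<inter> space M) \<le> ennreal K * emeasure G A"
  obtains v where "v \<in> borel_measurable borel" "\<And>x. \<bar>v x\<bar> \<le> Q * K"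
    "\<And>g B. g \<in> borel_measurable borel \<Longrightarrow> (\<And>x. \<bar>g x\<bar> \<le> B) \<Longrightarrow>
      (\<integral>p. q p * g (Z p) \<partial>M) = (\<integral>x. v x * g x \<partial>G)"
proof -
  interpret M: finite_measure M by fact
  interpret G: finite_measure G by fact
  have Q: "0 \<le> Q" using qQ abs_ge_zero order_trans by blast
  have qm: "0 \<le> max 0 (q p)" "max 0 (q p) \<le> Q" "0 \<le> max 0 (- q p)" "max 0 (- q p) \<le> Q" for p
    using qQ[of p] Q by auto
  obtain v1 where v1 [measurable]: "v1 \<in> borel_measurable borel" and b1: "\<And>x. 0 \<le> v1 x" "\<And>x. v1 x \<le> Q * K"
    and d1: "density G (\<lambda>x. ennreal (v1 x)) = distr (density M (\<lambda>p. ennreal (max 0 (q p)))) borel Z"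
    by (rule pushforward_density_nonneg[where q="\<lambda>p. max 0 (q p)", OF M G sG Z _ qm(1,2) K dom]) auto
  obtain v2 where v2 [measurable]: "v2 \<in> borel_measurable borel" and b2: "\<And>x. 0 \<le> v2 x" "\<And>x. v2 x \<le> Q * K"
    and d2: "density G (\<lambda>x. ennreal (v2 x)) = distr (density M (\<lambda>p. ennreal (max 0 (- q p)))) borel Z"
    by (rule pushforward_density_nonneg[where q="\<lambda>p. max 0 (- q p)", OF M G sG Z _ qm(3,4) K dom]) auto
  have push: "(\<integral>p. r p * g (Z p) \<partial>M) = (\<integral>x. v x * g x \<partial>G)"
    if [measurable]: "g \<in> borel_measurable borel" "v \<in> borel_measurable borel" "r \<in> borel_measurable M"
      and nn: "\<And>x. 0 \<le> v x" "\<And>p. 0 \<le> r p"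
      and d: "density G (\<lambda>x. ennreal (v x)) = distr (density M (\<lambda>p. ennreal (r p))) borel Z"
    for g v r
  proof -
    have "(\<integral>x. v x * g x \<partial>G) = (\<integral>x. g x \<partial>density G (\<lambda>x. ennreal (v x)))"
      using nn by (simp add: integral_density)
    also have "\<dots> = (\<integral>p. g (Z p) \<partial>density M (\<lambda>p. ennreal (r p)))"
      unfolding d by (subst integral_distr) auto
    also have "\<dots> = (\<integral>p. r p * g (Z p) \<partial>M)"
      using nn by (simp add: integral_density)
    finally show ?thesis by simp
  qed
  show ?thesis
  proof (rule that[of "\<lambda>x. v1 x - v2 x"])
    show "\<bar>v1 x - v2 x\<bar> \<le> Q * K" for x
      using b1[of x] b2[of x] by linarith
    fix g :: "'a \<Rightarrow> real" and B
    assume g [measurable]: "g \<in> borel_measurable borel" and B: "\<And>x. \<bar>g x\<bar> \<le> B"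
    have B0: "0 \<le> B" using B abs_ge_zero order_trans by blast
    have iM: "integrable M (\<lambda>p. r p * g (Z p))"
      if [measurable]: "r \<in> borel_measurable M" and "\<And>p. 0 \<le> r p" "\<And>p. r p \<le> Q" for r
      using that B B0 Q by (intro M.integrable_const_bound[where B="Q * B"]) (auto simp: abs_mult intro!: AE_I2 mult_mono)
    have iG: "integrable G (\<lambda>x. v x * g x)"
      if [measurable]: "v \<in> borel_measurable borel" and "\<And>x. 0 \<le> v x" "\<And>x. v x \<le> Q * K" for v
      using that B B0 Q K
      by (intro G.integrable_const_bound[where B="Q * K * B"]) (auto simp: abs_mult intro!: AE_I2 mult_mono)
    have "(\<integral>p. q p * g (Z p) \<partial>M) = (\<integral>p. max 0 (q p) * g (Z p) - max 0 (- q p) * g (Z p) \<partial>M)"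
      by (intro Bochner_Integration.integral_cong) (auto simp: max_def)
    also have "\<dots> = (\<integral>p. max 0 (q p) * g (Z p) \<partial>M) - (\<integral>p. max 0 (- q p) * g (Z p) \<partial>M)"
      by (intro Bochner_Integration.integral_diff iM qm) auto
    also have "\<dots> = (\<integral>x. v1 x * g x \<partial>G) - (\<integral>x. v2 x * g x \<partial>G)"
      using push[OF g v1 _ b1(1) qm(1) d1] push[OF g v2 _ b2(1) qm(3) d2] by simp
    also have "\<dots> = (\<integral>x. v1 x * g x - v2 x * g x \<partial>G)"
      by (intro Bochner_Integration.integral_diff[symmetric] iG b1 b2) auto
    finally show "(\<integral>p. q p * g (Z p) \<partial>M) = (\<integral>x. (v1 x - v2 x) * g x \<partial>G)"
      by (simp add: left_diff_distrib)
  qed auto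
qed

text \<open>The preimage under a dilation by \<open>c\<close> has volume \<open>c\<close> to the
  power minus the dimension times that of \<open>B\<close>, and \<open>1 / c\<close> is at most
  2.\<close>

lemma emeasure_lborel_affine_vimage_le:
  fixes t :: "'a::euclidean_space"
  assumes [measurable]: "B \<in> sets borel" and c: "1 / 2 \<le> c"
  shows "emeasure lborel {x. t + c *\<^sub>R x \<in> B} \<le> ennreal (2 ^ DIM('a)) * emeasure lborel B"
proof -
  have "emeasure lborel B = emeasure (density (distr lborel borel (\<lambda>x. t + c *\<^sub>R x)) (\<lambda>_. ennreal (\<bar>c\<bar> ^ DIM('a)))) B"
    using lborel_affine[of c t] c by simp
  also have "\<dots> = ennreal (c ^ DIM('a)) * emeasure lborel {x. t + c *\<^sub>R x \<in> B}"
    using c by (simp add: emeasure_density_const emeasure_distr vimage_def)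
  finally have *: "emeasure lborel B = ennreal (c ^ DIM('a)) * emeasure lborel {x. t + c *\<^sub>R x \<in> B}" .
  have "1 \<le> (2 * c) ^ DIM('a)" using c by (intro one_le_power) auto
  then have "1 * emeasure lborel {x. t + c *\<^sub>R x \<in> B} \<le> ennreal ((2 * c) ^ DIM('a)) * emeasure lborel {x. t + c *\<^sub>R x \<in> B}"
    by (intro mult_right_mono) auto
  also have "\<dots> = ennreal (2 ^ DIM('a)) * emeasure lborel B"
    using c unfolding * by (simp add: power_mult_distrib ennreal_mult mult.assoc)
  finally show ?thesis by simp
qed

section \<open>The segments of a bounded convex domain and their push-forward\<close>

locale bounded_convex_domain =
  fixes S :: "'a::euclidean_space set"
  assumes open_S: "open S" and bdd_S: "bounded S" and convex_S: "convex S" and S_ne: "S \<noteq> {}"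

sublocale bounded_convex_domain \<subseteq> bounded_borel_set S
  by standard (use open_S bdd_S in auto)

text \<open>Times and segment parameters are integrated against \<open>gamma_dom {0..1}\<close>, so
  they fall under the same lemmas as the points of the domain.\<close>

sublocale bounded_convex_domain \<subseteq> I: bounded_borel_set "{0..1::real}"
  by standard auto

context bounded_convex_domain
begin

lemma measure_gamma_dom: "measure (gamma_dom S) UNIV = measure lborel S"
  by (simp add: measure_def emeasure_gamma_dom)

lemma measure_pos: "0 < measure (gamma_dom S) UNIV"
proof -
  obtain x where "x \<in> S" using S_ne by auto
  then obtain r where "0 < r" "ball x r \<subseteq> S"
    using open_S by (auto elim: openE)
  then have "0 < measure lborel (ball x r)" by (simp add: content_ball_pos)
  also have "\<dots> \<le> measure lborel S"
    using \<open>ball x r \<subseteq> S\<close> emeasure_bounded_finite[OF bdd_S]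
    by (intro measure_mono_fmeasurable fmeasurableI) auto
  finally show ?thesis by (simp add: measure_gamma_dom)
qed

text \<open>Convexity enters here: for \<open>x\<close> and \<open>y\<close> in \<open>S\<close> the
  intermediate point is again in \<open>S\<close>. Hence only the part of \<open>A\<close> inside
  \<open>S\<close> is hit, and the right-hand side can be measured by
  \<open>gamma_dom S\<close>.\<close>

lemma emeasure_interpolate_le:
  assumes y: "y \<in> S" and s: "1 / 2 \<le> s" "s \<le> 1" and A [measurable]: "A \<in> sets borel"
  shows "emeasure (gamma_dom S) {x. (1 - s) *\<^sub>R y + s *\<^sub>R x \<in> A} \<le> ennreal (2 ^ DIM('a)) * emeasure (gamma_dom S) A"
proof -
  have "emeasure (gamma_dom S) {x. (1 - s) *\<^sub>R y + s *\<^sub>R x \<in> A} = emeasure lborel (S \<inter> {x. (1 - s) *\<^sub>R y + s *\<^sub>R x \<in> A})"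
    by (intro emeasure_gamma_dom) auto
  also have "\<dots> \<le> emeasure lborel {x. (1 - s) *\<^sub>R y + s *\<^sub>R x \<in> S \<inter> A}"
    using convex_S y s by (intro emeasure_mono) (auto simp: convex_alt)
  also have "\<dots> \<le> ennreal (2 ^ DIM('a)) * emeasure lborel (S \<inter> A)"
    using s by (intro emeasure_lborel_affine_vimage_le) auto
  finally show ?thesis by (simp add: emeasure_gamma_dom)
qed

definition segment_point :: "real \<times> 'a \<times> 'a \<Rightarrow> 'a" where
  "segment_point = (\<lambda>(s, x, y). (1 - s) *\<^sub>R y + s *\<^sub>R x)"

definition segments :: "(real \<times> 'a \<times> 'a) measure" where
  "segments = gamma_dom {0..1} \<Otimes>\<^sub>M (gamma_dom S \<Otimes>\<^sub>M gamma_dom S)"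

lemma sets_segments [measurable_cong]: "sets segments = sets (borel \<Otimes>\<^sub>M (borel \<Otimes>\<^sub>M borel))"
  unfolding segments_def by (intro sets_pair_measure_cong) auto

lemma space_segments [simp]: "space segments = UNIV"
  by (simp add: segments_def space_pair_measure)

lemma segment_point_measurable [measurable]: "segment_point \<in> borel_measurable (borel \<Otimes>\<^sub>M (borel \<Otimes>\<^sub>M borel))"
  unfolding segment_point_def by measurable

sublocale gam2: pair_sigma_finite "gamma_dom S" "gamma_dom S" ..

lemma finite_gam2: "finite_measure (gamma_dom S \<Otimes>\<^sub>M gamma_dom S)"
  by (intro finite_measure_pair_measure) unfold_locales

sublocale gam3: pair_sigma_finite "gamma_dom {0..1::real}" "gamma_dom S \<Otimes>\<^sub>M gamma_dom S"
proof -
  interpret finite_measure "gamma_dom S \<Otimes>\<^sub>M gamma_dom S" by (rule finite_gam2)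
  show "pair_sigma_finite (gamma_dom {0..1::real}) (gamma_dom S \<Otimes>\<^sub>M gamma_dom S)" ..
qed

lemma finite_segments: "finite_measure segments"
  unfolding segments_def by (intro finite_measure_pair_measure finite_gam2) unfold_locales

lemma segment_slice_le:
  assumes s: "0 \<le> s" "s \<le> 1" and A [measurable]: "A \<in> sets borel"
  shows "(\<integral>\<^sup>+ z. indicator A (segment_point (s, z)) \<partial>(gamma_dom S \<Otimes>\<^sub>M gamma_dom S))
    \<le> ennreal (2 ^ DIM('a) * measure (gamma_dom S) UNIV) * emeasure (gamma_dom S) A"
proof -
  let ?C = "ennreal (2 ^ DIM('a)) * emeasure (gamma_dom S) A"
  have const: "(\<integral>\<^sup>+ x. ?C \<partial>gamma_dom S) = ennreal (2 ^ DIM('a) * measure (gamma_dom S) UNIV) * emeasure (gamma_dom S) A"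
    by (simp add: gam.emeasure_eq_measure ennreal_mult[symmetric] mult_ac)
  show ?thesis
  proof (cases "1 / 2 \<le> s")
    case True
    have "(\<integral>\<^sup>+ z. indicator A (segment_point (s, z)) \<partial>(gamma_dom S \<Otimes>\<^sub>M gamma_dom S))
        = (\<integral>\<^sup>+ y. (\<integral>\<^sup>+ x. indicator A (segment_point (s, x, y)) \<partial>gamma_dom S) \<partial>gamma_dom S)"
      by (subst gam2.nn_integral_snd[symmetric]) auto
    also have "\<dots> \<le> (\<integral>\<^sup>+ y. ?C \<partial>gamma_dom S)"
    proof (rule nn_integral_mono_AE, use AE_gamma_dom[OF borel_S] in eventually_elim)
      fix y assume "y \<in> S"
      have "(\<integral>\<^sup>+ x. indicator A (segment_point (s, x, y)) \<partial>gamma_dom S)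
          = (\<integral>\<^sup>+ x. indicator {x. (1 - s) *\<^sub>R y + s *\<^sub>R x \<in> A} x \<partial>gamma_dom S)"
        by (intro nn_integral_cong) (auto simp: segment_point_def indicator_def)
      also have "\<dots> \<le> ?C"
        using emeasure_interpolate_le[OF \<open>y \<in> S\<close> True s(2) A] by (subst nn_integral_indicator) auto
      finally show "(\<integral>\<^sup>+ x. indicator A (segment_point (s, x, y)) \<partial>gamma_dom S) \<le> ?C" .
    qed
    finally show ?thesis using const by simp
  next
    case False
    then have s': "1 / 2 \<le> 1 - s" "1 - s \<le> 1" using s by auto
    have "(\<integral>\<^sup>+ z. indicator A (segment_point (s, z)) \<partial>(gamma_dom S \<Otimes>\<^sub>M gamma_dom S))
        = (\<integral>\<^sup>+ x. (\<integral>\<^sup>+ y. indicator A (segment_point (s, x, y)) \<partial>gamma_dom S) \<partial>gamma_dom S)"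
      by (subst gam.nn_integral_fst[symmetric]) auto
    also have "\<dots> \<le> (\<integral>\<^sup>+ x. ?C \<partial>gamma_dom S)"
    proof (rule nn_integral_mono_AE, use AE_gamma_dom[OF borel_S] in eventually_elim)
      fix x assume "x \<in> S"
      have "(\<integral>\<^sup>+ y. indicator A (segment_point (s, x, y)) \<partial>gamma_dom S)
          = (\<integral>\<^sup>+ y. indicator {y. (1 - (1 - s)) *\<^sub>R x + (1 - s) *\<^sub>R y \<in> A} y \<partial>gamma_dom S)"
        by (intro nn_integral_cong) (auto simp: segment_point_def indicator_def add.commute)
      also have "\<dots> \<le> ?C"
        using emeasure_interpolate_le[OF \<open>x \<in> S\<close> s' A] by (subst nn_integral_indicator) auto
      finally show "(\<integral>\<^sup>+ y. indicator A (segment_point (s, x, y)) \<partial>gamma_dom S) \<le> ?C" .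
    qed
    finally show ?thesis using const by simp
  qed
qed

text \<open>The bound for a fixed parameter is uniform and \<open>{0..1}\<close> has mass 1. The
  result is the domination hypothesis of \<open>pushforward_density\<close>.\<close>

lemma segments_vimage_le:
  assumes A [measurable]: "A \<in> sets borel"
  shows "emeasure segments (segment_point -` A \<inter> space segments)
    \<le> ennreal (2 ^ DIM('a) * measure (gamma_dom S) UNIV) * emeasure (gamma_dom S) A"
proof -
  let ?C = "ennreal (2 ^ DIM('a) * measure (gamma_dom S) UNIV) * emeasure (gamma_dom S) A"
  have "emeasure segments (segment_point -` A \<inter> space segments)
      = (\<integral>\<^sup>+ p. indicator (segment_point -` A \<inter> space segments) p \<partial>segments)"
    by (intro nn_integral_indicator[symmetric] measurable_sets[of _ _ borel]) auto
  also have "\<dots> = (\<integral>\<^sup>+ p. indicator A (segment_point p) \<partial>segments)"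
    by (intro nn_integral_cong) (auto simp: indicator_def)
  also have "\<dots> = (\<integral>\<^sup>+ s. (\<integral>\<^sup>+ z. indicator A (segment_point (s, z)) \<partial>(gamma_dom S \<Otimes>\<^sub>M gamma_dom S)) \<partial>gamma_dom {0..1})"
    unfolding segments_def by (subst sigma_finite_measure.nn_integral_fst[OF finite_measure.axioms(1)[OF finite_gam2], symmetric]) auto
  also have "\<dots> \<le> (\<integral>\<^sup>+ s. ?C \<partial>gamma_dom {0..1::real})"
    using AE_gamma_dom[OF I.borel_S] by (intro nn_integral_mono_AE) (auto intro!: segment_slice_le)
  also have "\<dots> = ?C"
    by (simp add: emeasure_gamma_dom)
  finally show ?thesis .
qed

lemma integral_along_segment:
  fixes \<zeta> :: "'a \<Rightarrow> real" and G :: "'a \<Rightarrow> 'a"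
  assumes \<zeta>: "\<And>x. (\<zeta> has_derivative (\<lambda>h. G x \<bullet> h)) (at x)" and G: "continuous_on UNIV G"
  shows "(\<integral>s. G (segment_point (s, x, y)) \<bullet> (x - y) \<partial>gamma_dom {0..1}) = \<zeta> x - \<zeta> y"
proof -
  let ?l = "\<lambda>s. y + s *\<^sub>R (x - y)"
  have l: "segment_point (s, x, y) = ?l s" for s
    by (simp add: segment_point_def algebra_simps)
  have cont: "continuous_on UNIV (\<lambda>s. G (?l s) \<bullet> (x - y))"
    by (intro continuous_intros continuous_on_compose2[OF G]) auto
  have deriv: "((\<lambda>s. \<zeta> (?l s)) has_vector_derivative G (?l s) \<bullet> (x - y)) (at s within {0..1})" for s
  proof -
    have "(?l has_derivative (\<lambda>h. h *\<^sub>R (x - y))) (at s within {0..1})"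
      by (auto intro!: derivative_eq_intros)
    from diff_chain_within[OF this has_derivative_at_withinI[OF \<zeta>]]
    show ?thesis
      by (simp add: has_vector_derivative_def o_def)
  qed
  have "(\<integral>s. G (?l s) \<bullet> (x - y) \<partial>gamma_dom {0..1}) = (LINT s:{0..1}|lborel. G (?l s) \<bullet> (x - y))"
    using borel_measurable_continuous_onI[OF cont] by (simp add: LINT_eq_gamma_dom)
  also have "\<dots> = \<zeta> (?l 1) - \<zeta> (?l 0)"
    unfolding set_lebesgue_integral_def
    by (rule integral_FTC_atLeastAtMost[where F="\<lambda>s. \<zeta> (?l s)"])
      (auto intro: deriv continuous_on_subset[OF cont])
  finally show ?thesis by (simp add: l)
qed

text \<open>The test functions are bounded with bounded gradient but need not vanish near the
  boundary of \<open>S\<close>. The identity therefore contains the no-flux condition, and constant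
  test functions force \<open>f\<close> to have mean zero. \<open>G\<close> is the gradient of
  \<open>\<zeta>\<close>.\<close>

definition neg_weak_divergence :: "('a \<Rightarrow> 'a) \<Rightarrow> ('a \<Rightarrow> real) \<Rightarrow> bool" where
  "neg_weak_divergence w f \<longleftrightarrow>
     (\<forall>\<zeta> G B. (\<forall>x. (\<zeta> has_derivative (\<lambda>h. G x \<bullet> h)) (at x)) \<longrightarrow> continuous_on UNIV G \<longrightarrow>
        (\<forall>x. norm (G x) \<le> B) \<longrightarrow> (\<forall>x. \<bar>\<zeta> x\<bar> \<le> B) \<longrightarrow>
        (\<integral>x. f x * \<zeta> x \<partial>gamma_dom S) = (\<integral>x. G x \<bullet> w x \<partial>gamma_dom S))"

text \<open>
  For \<open>f\<close> of mean zero, \<open>\<integral>f\<zeta> = |S|\<inverse> \<integral>\<integral>f(x)(\<zeta>(x) - \<zeta>(y)) dx dy\<close>, and the difference is the integral of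
  \<open>\<nabla>\<zeta>\<close> along the segment from \<open>y\<close> to \<open>x\<close>. Hence \<open>w\<close> is the density of the push-forward of
  \<open>|S|\<inverse> f(x)(x - y) ds dx dy\<close> under \<open>(s, x, y) \<mapsto> (1 - s)y + sx\<close>; it is bounded because for each \<open>s\<close>
  one of the coefficients \<open>s\<close>, \<open>1 - s\<close> is at least 1/2.
\<close>

lemma bounded_divergence_solution:
  obtains D where "\<And>f C. f \<in> borel_measurable borel \<Longrightarrow> (\<And>x. \<bar>f x\<bar> \<le> C) \<Longrightarrow> (\<integral>x. f x \<partial>gamma_dom S) = 0 \<Longrightarrow>
      \<exists>w\<in>borel_measurable borel. (\<forall>x. norm (w x) \<le> C * D) \<and> neg_weak_divergence w f"
proof -
  define V where "V = measure (gamma_dom S) UNIV"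
  have V: "0 < V" unfolding V_def by (rule measure_pos)
  obtain d where d: "0 < d" "\<And>x. x \<in> S \<Longrightarrow> norm x \<le> d"
    using bdd_S bounded_pos by blast
  \<comment> \<open>\<open>2 * d\<close> bounds the length of a segment and \<open>1 / V\<close>
    normalizes the average; \<open>2 ^ DIM('a) * V\<close> is the constant of
    \<open>segments_vimage_le\<close>, and \<open>DIM('a)\<close> is lost in passing from the
    coordinates to the norm.\<close>
  define D where "D = real DIM('a) * (2 * d / V * (2 ^ DIM('a) * V))"
  interpret seg: finite_measure segments by (rule finite_segments)
  interpret g2: finite_measure "gamma_dom S \<Otimes>\<^sub>M gamma_dom S" by (rule finite_gam2)
  have main: "\<exists>w\<in>borel_measurable borel. (\<forall>x. norm (w x) \<le> C * D) \<and> neg_weak_divergence w f"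
    if f [measurable]: "f \<in> borel_measurable borel" and C: "\<And>x. \<bar>f x\<bar> \<le> C"
      and f0: "(\<integral>x. f x \<partial>gamma_dom S) = 0" for f C
  proof -
    have C0: "0 \<le> C" using C abs_ge_zero order_trans by blast
    \<comment> \<open>The \<open>i\<close>-th component of the vector weight carried by a segment.
      The indicators are 1 almost everywhere for \<open>segments\<close>; they make the bound on the
      weight hold at every point, as \<open>pushforward_density\<close> demands.\<close>
    define q where "q i = (\<lambda>(s::real, x, y). indicator S x * indicator S y * (f x / V * ((x - y) \<bullet> i)))" for i :: 'a
    have q_meas [measurable]: "q i \<in> borel_measurable segments" for i
      unfolding q_def by measurable
    have q_bd: "\<bar>q i p\<bar> \<le> C * (2 * d / V)" if "i \<in> Basis" for i p
    proof -
      obtain s x y where p: "p = (s, x, y)" by (metis surj_pair)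
      show ?thesis
      proof (cases "x \<in> S \<and> y \<in> S")
        case True
        have "\<bar>(x - y) \<bullet> i\<bar> \<le> norm (x - y)" by (rule Basis_le_norm[OF that])
        also have "\<dots> \<le> 2 * d" using d(2)[of x] d(2)[of y] True norm_triangle_ineq4[of x y] by linarith
        finally have "\<bar>f x\<bar> * \<bar>(x - y) \<bullet> i\<bar> \<le> C * (2 * d)"
          using C[of x] C0 by (intro mult_mono) auto
        then show ?thesis
          using True V by (auto simp: p q_def abs_mult divide_right_mono field_simps)
      next
        case False
        then have "q i p = 0" by (auto simp: p q_def)
        then show ?thesis using C0 d V by simp
      qed
    qed
    let ?P = "\<lambda>i v. v \<in> borel_measurable borel \<and> (\<forall>x. \<bar>v x\<bar> \<le> C * (2 * d / V) * (2 ^ DIM('a) * V)) \<and>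
      (\<forall>g B. g \<in> borel_measurable borel \<longrightarrow> (\<forall>x. \<bar>g x\<bar> \<le> B) \<longrightarrow>
        (\<integral>p. q i p * g (segment_point p) \<partial>segments) = (\<integral>x. v x * g x \<partial>gamma_dom S))"
    have ex: "\<exists>v. ?P i v" if "i \<in> Basis" for i
    proof -
      have Z: "segment_point \<in> segments \<rightarrow>\<^sub>M borel" by measurable
      have K: "0 \<le> 2 ^ DIM('a) * V" using V by simp
      have dom: "emeasure segments (segment_point -` A \<inter> space segments)
          \<le> ennreal (2 ^ DIM('a) * V) * emeasure (gamma_dom S) A" if "A \<in> sets borel" for A
        unfolding V_def by (rule segments_vimage_le[OF that])
      show ?thesis
        by (rule pushforward_density[where Z=segment_point and q="q i",
              OF finite_segments gam.finite_measure_axioms sets_gamma_dom Z q_meas q_bd[OF that] K dom])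
          (assumption, blast)
    qed
    have "\<exists>v. \<forall>i\<in>Basis. ?P i (v i)"
      by (rule bchoice) (use ex in blast)
    then obtain v where vP: "\<forall>i\<in>Basis. ?P i (v i)" ..
    have v [measurable]: "v i \<in> borel_measurable borel" if "i \<in> Basis" for i
      using bspec[OF vP that] by simp
    have v_bd: "\<bar>v i x\<bar> \<le> C * (2 * d / V) * (2 ^ DIM('a) * V)" if "i \<in> Basis" for i x
      using bspec[OF vP that] by simp
    have v_int: "(\<integral>p. q i p * g (segment_point p) \<partial>segments) = (\<integral>x. v i x * g x \<partial>gamma_dom S)"
      if "i \<in> Basis" "g \<in> borel_measurable borel" "\<And>x. \<bar>g x\<bar> \<le> B" for i g B
      using bspec[OF vP that(1)] that(2,3) by blast
    define w where "w x = (\<Sum>i\<in>Basis. v i x *\<^sub>R i)" for x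
    have wi: "w x \<bullet> i = v i x" if "i \<in> Basis" for x i
      unfolding w_def using that by simp
    have w [measurable]: "w \<in> borel_measurable borel"
      unfolding w_def by (intro borel_measurable_sum borel_measurable_scaleR v) auto
    have w_bd: "norm (w x) \<le> C * D" for x
    proof -
      have "norm (w x) \<le> (\<Sum>i\<in>Basis. \<bar>w x \<bullet> i\<bar>)" by (rule norm_le_l1)
      also have "\<dots> \<le> (\<Sum>i\<in>(Basis::'a set). C * (2 * d / V) * (2 ^ DIM('a) * V))"
        by (intro sum_mono) (simp only: wi v_bd)
      finally show ?thesis using V by (simp add: D_def mult_ac)
    qed
    have "(\<integral>x. f x * \<zeta> x \<partial>gamma_dom S) = (\<integral>x. G x \<bullet> w x \<partial>gamma_dom S)"
      if \<zeta>: "\<And>x. (\<zeta> has_derivative (\<lambda>h. G x \<bullet> h)) (at x)" and Gc: "continuous_on UNIV G"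
        and GB: "\<And>x. norm (G x) \<le> B" and \<zeta>B: "\<And>x. \<bar>\<zeta> x\<bar> \<le> B" for \<zeta> G B
    proof -
      have B0: "0 \<le> B" using \<zeta>B abs_ge_zero order_trans by blast
      have G [measurable]: "G \<in> borel_measurable borel"
        using Gc by (rule borel_measurable_continuous_onI)
      have "continuous_on UNIV \<zeta>"
        using \<zeta> by (meson continuous_at_imp_continuous_on has_derivative_continuous)
      then have \<zeta>m [measurable]: "\<zeta> \<in> borel_measurable borel"
        by (rule borel_measurable_continuous_onI)
      have GiB: "\<bar>G x \<bullet> i\<bar> \<le> B" if "i \<in> Basis" for x i
        using GB[of x] Basis_le_norm[OF that, of "G x"] by linarith
      have int_Gw: "integrable (gamma_dom S) (\<lambda>x. v i x * (G x \<bullet> i))" if "i \<in> Basis" for i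
        using that B0 GiB v_bd v C0 d V
        by (intro integrable_bounded[where K="C * (2 * d / V) * (2 ^ DIM('a) * V) * B"])
          (auto simp: abs_mult intro!: mult_mono)
      have int_q: "integrable segments (\<lambda>p. q i p * (G (segment_point p) \<bullet> i))" if "i \<in> Basis" for i
      proof (rule seg.integrable_const_bound[where B="C * (2 * d / V) * B"], rule AE_I2)
        show "norm (q i p * (G (segment_point p) \<bullet> i)) \<le> C * (2 * d / V) * B" for p
          unfolding real_norm_def abs_mult
          by (rule mult_mono[OF q_bd[OF that] GiB[OF that]]) (use C0 d V in auto)
      qed measurable
      \<comment> \<open>Summing over the coordinates restores the inner product of the gradient with
        \<open>x - y\<close>, which is the derivative of \<open>\<zeta>\<close> along the segment
        and can be integrated in \<open>s\<close>.\<close>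
      define F where "F = (\<lambda>s (x, y). indicator S x * indicator S y * (f x / V * (G (segment_point (s, x, y)) \<bullet> (x - y))))"
      have F: "(\<Sum>i\<in>Basis. q i p * (G (segment_point p) \<bullet> i)) = case_prod F p" for p
      proof -
        obtain s x y where p: "p = (s, x, y)" by (metis surj_pair)
        show ?thesis
          unfolding p F_def q_def prod.case
          by (subst (3) euclidean_inner) (simp add: sum_distrib_left mult_ac)
      qed
      have "(\<integral>x. G x \<bullet> w x \<partial>gamma_dom S) = (\<integral>x. (\<Sum>i\<in>Basis. v i x * (G x \<bullet> i)) \<partial>gamma_dom S)"
        by (subst euclidean_inner) (simp add: wi mult.commute)
      also have "\<dots> = (\<Sum>i\<in>Basis. \<integral>x. v i x * (G x \<bullet> i) \<partial>gamma_dom S)"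
        by (intro Bochner_Integration.integral_sum int_Gw)
      also have "\<dots> = (\<Sum>i\<in>Basis. \<integral>p. q i p * (G (segment_point p) \<bullet> i) \<partial>segments)"
        using GiB by (intro sum.cong refl v_int[symmetric, where B=B]) auto
      also have "\<dots> = (\<integral>p. (\<Sum>i\<in>Basis. q i p * (G (segment_point p) \<bullet> i)) \<partial>segments)"
        by (intro Bochner_Integration.integral_sum[symmetric] int_q)
      also have "\<dots> = (\<integral>p. case_prod F p \<partial>segments)"
        by (simp only: F)
      also have "\<dots> = (\<integral>z. (\<integral>s. F s z \<partial>gamma_dom {0..1}) \<partial>(gamma_dom S \<Otimes>\<^sub>M gamma_dom S))"
      proof -
        have "integrable segments (\<lambda>p. (\<Sum>i\<in>Basis. q i p * (G (segment_point p) \<bullet> i)))"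
          by (intro Bochner_Integration.integrable_sum int_q)
        then have "integrable segments (case_prod F)" by (simp only: F)
        then show ?thesis
          unfolding segments_def by (intro gam3.integral_snd[symmetric])
      qed
      also have "\<dots> = (\<integral>z. (case z of (x, y) \<Rightarrow> indicator S x * indicator S y * (f x / V * (\<zeta> x - \<zeta> y))) \<partial>(gamma_dom S \<Otimes>\<^sub>M gamma_dom S))"
        by (intro Bochner_Integration.integral_cong refl)
          (auto simp: F_def integral_along_segment[OF \<zeta> Gc] split: prod.split)
      also have "\<dots> = (\<integral>x. (\<integral>y. indicator S x * indicator S y * (f x / V * (\<zeta> x - \<zeta> y)) \<partial>gamma_dom S) \<partial>gamma_dom S)"
      proof (rule gam2.integral_fst[symmetric], rule g2.integrable_const_bound[where B="C / V * (2 * B)"])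
        have "\<bar>indicator S x * indicator S y * (f x / V * (\<zeta> x - \<zeta> y))\<bar> \<le> C / V * (2 * B)" for x y
        proof -
          have "\<bar>f x\<bar> / V * \<bar>\<zeta> x - \<zeta> y\<bar> \<le> C / V * (2 * B)"
            using C[of x] \<zeta>B[of x] \<zeta>B[of y] V C0 by (intro mult_mono divide_right_mono) auto
          moreover have "0 \<le> C / V * (2 * B)" using C0 V B0 by simp
          ultimately show ?thesis using V by (auto simp: indicator_def abs_mult)
        qed
        then show "AE z in gamma_dom S \<Otimes>\<^sub>M gamma_dom S.
            norm (case z of (x, y) \<Rightarrow> indicator S x * indicator S y * (f x / V * (\<zeta> x - \<zeta> y))) \<le> C / V * (2 * B)"
          by (auto split: prod.split)
      qed measurable
      \<comment> \<open>The integral over \<open>y\<close> replaces \<open>\<zeta> y\<close> by its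
        mean value, and the term with this mean is later removed by \<open>f0\<close>.\<close>
      also have "\<dots> = (\<integral>x. f x * \<zeta> x - f x * ((\<integral>y. \<zeta> y \<partial>gamma_dom S) / V) \<partial>gamma_dom S)"
      proof (rule integral_cong_AE)
        show "AE x in gamma_dom S. (\<integral>y. indicator S x * indicator S y * (f x / V * (\<zeta> x - \<zeta> y)) \<partial>gamma_dom S)
           = f x * \<zeta> x - f x * ((\<integral>y. \<zeta> y \<partial>gamma_dom S) / V)"
          using AE_gamma_dom[OF borel_S]
        proof eventually_elim
          case (elim x)
          have "(\<integral>y. indicator S x * indicator S y * (f x / V * (\<zeta> x - \<zeta> y)) \<partial>gamma_dom S)
              = (\<integral>y. f x / V * (\<zeta> x - \<zeta> y) \<partial>gamma_dom S)"
          proof (rule integral_cong_AE)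
            show "AE y in gamma_dom S. indicator S x * indicator S y * (f x / V * (\<zeta> x - \<zeta> y)) = f x / V * (\<zeta> x - \<zeta> y)"
              using AE_gamma_dom[OF borel_S] by eventually_elim (use elim in simp)
          qed measurable
          also have "\<dots> = f x / V * (V * \<zeta> x - (\<integral>y. \<zeta> y \<partial>gamma_dom S))"
            using integrable_bounded[of \<zeta> B] \<zeta>B by (simp add: V_def)
          also have "\<dots> = f x * \<zeta> x - f x * ((\<integral>y. \<zeta> y \<partial>gamma_dom S) / V)"
            using V by (simp add: field_simps)
          finally show ?case .
        qed
      qed measurable
      also have "\<dots> = (\<integral>x. f x * \<zeta> x \<partial>gamma_dom S) - (\<integral>x. f x \<partial>gamma_dom S) * ((\<integral>y. \<zeta> y \<partial>gamma_dom S) / V)"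
      proof -
        have "integrable (gamma_dom S) f" using C by (intro integrable_bounded[where K=C]) auto
        moreover have "integrable (gamma_dom S) (\<lambda>x. f x * \<zeta> x)"
          using C \<zeta>B C0 by (intro integrable_bounded[where K="C * B"]) (auto simp: abs_mult intro!: mult_mono)
        ultimately show ?thesis by simp
      qed
      finally show ?thesis by (simp add: f0)
    qed
    with w w_bd show ?thesis unfolding neg_weak_divergence_def by blast
  qed
  show ?thesis by (rule that) (use main in blast)
qed

end

section \<open>The connecting path\<close>

lemma bounded_if_compact_supp:
  fixes h :: "'c::topological_space \<Rightarrow> 'b::real_normed_vector"
  assumes "continuous_on UNIV h" "compact K" "\<And>p. p \<notin> K \<Longrightarrow> h p = 0"
  obtains B where "0 \<le> B" "\<And>p. norm (h p) \<le> B"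
proof -
  have "compact (h ` K)"
    using assms by (meson compact_continuous_image continuous_on_subset subset_UNIV)
  then obtain B where B: "\<And>p. p \<in> K \<Longrightarrow> norm (h p) \<le> B"
    by (meson bounded_iff compact_imp_bounded imageI)
  have "norm (h p) \<le> max 0 B" for p
    using assms(3)[of p] B[of p] by (cases "p \<in> K") auto
  then show ?thesis using that[of "max 0 B"] by auto
qed

lemma zero_outside_supp_fun: "p \<notin> supp_fun h \<Longrightarrow> h p = 0"
  using closure_subset[of "{x. h x \<noteq> 0}"] unfolding supp_fun_def by auto

locale test_function =
  fixes \<zeta> :: "'a::euclidean_space \<times> real \<Rightarrow> real"
  assumes C1: "Ck 1 \<zeta>" and compact_supp: "compact (supp_fun \<zeta>)"
    and supp_in: "supp_fun \<zeta> \<subseteq> UNIV \<times> {0<..<1}"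
begin

lemma deriv: "(\<zeta> has_derivative frechet_derivative \<zeta> (at p)) (at p)"
  using C1 by (simp del: split_paired_All add: frechet_derivative_works)

lemma deriv_continuous: "continuous_on UNIV (\<lambda>p. frechet_derivative \<zeta> (at p) v)"
  using C1 by (simp del: split_paired_All)

lemma cont: "continuous_on UNIV \<zeta>"
  by (rule has_derivative_continuous_on[OF has_derivative_at_withinI[OF deriv]])

lemma zero_ends: "\<zeta> (x, 0) = 0" "\<zeta> (x, 1) = 0"
  using supp_in by (auto intro!: zero_outside_supp_fun[of _ \<zeta>])

lemma deriv_zero_outside:
  assumes "p \<notin> supp_fun \<zeta>"
  shows "frechet_derivative \<zeta> (at p) v = 0"
proof -
  have "((\<lambda>_. 0::real) has_derivative (\<lambda>_. 0)) (at p)" by simp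
  then have "(\<zeta> has_derivative (\<lambda>_. 0)) (at p)"
    by (rule has_derivative_transform_within_open[where s="- supp_fun \<zeta>"])
      (use assms zero_outside_supp_fun in \<open>auto simp: supp_fun_def\<close>)
  then have "(\<lambda>_. 0) = frechet_derivative \<zeta> (at p)" by (rule frechet_derivative_at)
  then show ?thesis by (metis (full_types))
qed

lemma dt_continuous: "continuous_on UNIV (\<lambda>p. dt \<zeta> (snd p) (fst p))"
  using deriv_continuous[of "(0, 1)"] by (simp add: dt_def)

lemma grad_continuous: "continuous_on UNIV (\<lambda>p. grad_x \<zeta> (snd p) (fst p))"
  unfolding grad_x_def prod.collapse
  by (intro continuous_on_sum continuous_on_scaleR deriv_continuous continuous_on_const)

text \<open>A single constant is produced because \<open>neg_weak_divergence\<close> bounds a test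
  function and its gradient by the same \<open>B\<close>.\<close>

lemma bounds:
  obtains B where "0 \<le> B" "\<And>p. \<bar>\<zeta> p\<bar> \<le> B" "\<And>t x. \<bar>dt \<zeta> t x\<bar> \<le> B" "\<And>t x. norm (grad_x \<zeta> t x) \<le> B"
proof -
  obtain B1 where B1: "0 \<le> B1" "\<And>p. norm (\<zeta> p) \<le> B1"
    by (rule bounded_if_compact_supp[OF cont compact_supp zero_outside_supp_fun[where h=\<zeta>]]) blast+
  obtain B2 where B2: "0 \<le> B2" "\<And>p. norm (dt \<zeta> (snd p) (fst p)) \<le> B2"
    using bounded_if_compact_supp[OF dt_continuous compact_supp]
    by (auto simp: dt_def deriv_zero_outside)
  obtain B3 where B3: "0 \<le> B3" "\<And>p. norm (grad_x \<zeta> (snd p) (fst p)) \<le> B3"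
    using bounded_if_compact_supp[OF grad_continuous compact_supp]
    by (auto simp: grad_x_def deriv_zero_outside)
  show ?thesis
  proof (rule that[of "B1 + B2 + B3"])
    show "\<bar>\<zeta> p\<bar> \<le> B1 + B2 + B3" for p using B1(2)[of p] B1(1) B2(1) B3(1) by simp
    show "\<bar>dt \<zeta> t x\<bar> \<le> B1 + B2 + B3" for t x using B2(2)[of "(x, t)"] B1(1) B2(1) B3(1) by simp
    show "norm (grad_x \<zeta> t x) \<le> B1 + B2 + B3" for t x using B3(2)[of "(x, t)"] B1(1) B2(1) B3(1) by simp
  qed (use B1 B2 B3 in simp)
qed

text \<open>Presents a time slice of \<open>\<zeta>\<close> in the form over which
  \<open>neg_weak_divergence\<close> quantifies.\<close>

lemma deriv_space: "((\<lambda>x. \<zeta> (x, t)) has_derivative (\<lambda>h. grad_x \<zeta> t x \<bullet> h)) (at x)"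
proof -
  let ?D = "frechet_derivative \<zeta> (at (x, t))"
  interpret D: bounded_linear ?D using deriv by (rule has_derivative_bounded_linear)
  have "((\<lambda>x. (x, t)) has_derivative (\<lambda>h. (h, 0))) (at x)"
    by (auto intro!: derivative_eq_intros)
  from diff_chain_at[OF this deriv]
  have "((\<lambda>x. \<zeta> (x, t)) has_derivative (\<lambda>h. ?D (h, 0))) (at x)"
    by (simp add: o_def)
  moreover have "?D (h, 0) = grad_x \<zeta> t x \<bullet> h" for h
  proof -
    have "(h, 0) = (\<Sum>i\<in>Basis. (h \<bullet> i) *\<^sub>R (i, 0::real))"
      by (simp add: prod_eq_iff fst_sum snd_sum euclidean_representation)
    then have "?D (h, 0) = ?D (\<Sum>i\<in>Basis. (h \<bullet> i) *\<^sub>R (i, 0))"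
      by (rule arg_cong)
    also have "\<dots> = (\<Sum>i\<in>Basis. (h \<bullet> i) *\<^sub>R ?D (i, 0))"
      by (simp only: D.sum D.scaleR)
    also have "\<dots> = grad_x \<zeta> t x \<bullet> h"
      by (simp add: grad_x_def inner_sum_left inner_commute[of h] mult.commute)
    finally show ?thesis .
  qed
  ultimately show ?thesis by simp
qed

lemma deriv_time: "((\<lambda>t. \<zeta> (x, t)) has_real_derivative dt \<zeta> t x) (at t)"
proof -
  let ?D = "frechet_derivative \<zeta> (at (x, t))"
  interpret D: bounded_linear ?D using deriv by (rule has_derivative_bounded_linear)
  have "((\<lambda>t. (x, t)) has_derivative (\<lambda>h. (0, h))) (at t)"
    by (auto intro!: derivative_eq_intros)
  from diff_chain_at[OF this deriv]
  have "((\<lambda>t. \<zeta> (x, t)) has_derivative (\<lambda>h. ?D (0, h))) (at t)"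
    by (simp add: o_def)
  moreover have "?D (0, h) = dt \<zeta> t x * h" for h
    using D.scaleR[of h "(0, 1)"] by (simp add: dt_def mult.commute)
  ultimately show ?thesis by (simp add: has_field_derivative_def)
qed

end

section \<open>The continuity equation along a path with time-dependent coefficients\<close>

context bounded_convex_domain
begin

lemma total_variation_path_finite:
  fixes g :: "real \<Rightarrow> 'a \<Rightarrow> 'b::euclidean_space"
  assumes "\<And>t. g t \<in> borel_measurable borel" and K: "\<And>t x. norm (g t x) \<le> K"
  shows "(\<integral>\<^sup>+ t\<in>{0..1}. total_variation (with_density (g t) (gamma_dom S)) A \<partial>lborel) < \<infinity>"
proof -
  have "(\<integral>\<^sup>+ t\<in>{0..1}. total_variation (with_density (g t) (gamma_dom S)) A \<partial>lborel)
      \<le> (\<integral>\<^sup>+ t\<in>{0..1::real}. ennreal (K * measure (gamma_dom S) UNIV) \<partial>lborel)"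
    using assms by (intro nn_integral_mono mult_right_mono total_variation_with_density) auto
  also have "\<dots> < \<infinity>" by (simp add: nn_integral_cmult_indicator)
  finally show ?thesis .
qed

text \<open>The weak divergence identity, applied to each time slice, turns the pairing of flux and
  gradient into the integral of \<open>\<zeta>\<close> times the time derivative of the density.
  Together with the other term this is the time derivative of \<open>\<zeta>\<close> times the
  density, and \<open>\<zeta>\<close> vanishes at both ends of the time interval.\<close>

lemma with_density_path_in_CE:
  fixes f0 f1 :: "'a \<Rightarrow> real" and w0 w1 :: "'a \<Rightarrow> 'a" and \<alpha> \<beta> \<alpha>' \<beta>' :: "real \<Rightarrow> real"
  assumes f [measurable]: "f0 \<in> borel_measurable borel" "f1 \<in> borel_measurable borel"
    and fC: "\<And>x. \<bar>f0 x\<bar> \<le> C" "\<And>x. \<bar>f1 x\<bar> \<le> C"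
    and w [measurable]: "w0 \<in> borel_measurable borel" "w1 \<in> borel_measurable borel"
    and wR: "\<And>x. norm (w0 x) \<le> R" "\<And>x. norm (w1 x) \<le> R"
    and div0: "neg_weak_divergence w0 f0" and div1: "neg_weak_divergence w1 f1"
    and \<alpha>: "\<And>t. (\<alpha> has_real_derivative \<alpha>' t) (at t)" "continuous_on UNIV \<alpha>'"
      "\<And>t. \<bar>\<alpha> t\<bar> \<le> L" "\<And>t. \<bar>\<alpha>' t\<bar> \<le> L"
    and \<beta>: "\<And>t. (\<beta> has_real_derivative \<beta>' t) (at t)" "continuous_on UNIV \<beta>'"
      "\<And>t. \<bar>\<beta> t\<bar> \<le> L" "\<And>t. \<bar>\<beta>' t\<bar> \<le> L"
  shows "(\<lambda>t. with_density (\<lambda>x. m + \<alpha> t * f0 x + \<beta> t * f1 x) (gamma_dom S),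
          \<lambda>t. with_density (\<lambda>x. \<alpha>' t *\<^sub>R w0 x + \<beta>' t *\<^sub>R w1 x) (gamma_dom S)) \<in> CE 1"
proof -
  define \<rho> where "\<rho> t x = m + \<alpha> t * f0 x + \<beta> t * f1 x" for t x
  define u where "u t x = \<alpha>' t *\<^sub>R w0 x + \<beta>' t *\<^sub>R w1 x" for t x
  let ?\<mu> = "\<lambda>t. with_density (\<rho> t) (gamma_dom S)" and ?\<nu> = "\<lambda>t. with_density (u t) (gamma_dom S)"
  have L: "0 \<le> L" and C: "0 \<le> C" and R: "0 \<le> R"
    using \<alpha>(3)[of 0] fC(1)[of 0] wR(1)[of 0] norm_ge_zero[of "w0 0"] by linarith+
  have \<alpha>c: "continuous_on UNIV \<alpha>" and \<beta>c: "continuous_on UNIV \<beta>"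
    using \<alpha>(1) \<beta>(1) by (auto intro!: DERIV_continuous_on)
  have [measurable]: "\<alpha> \<in> borel_measurable borel" "\<beta> \<in> borel_measurable borel"
    "\<alpha>' \<in> borel_measurable borel" "\<beta>' \<in> borel_measurable borel"
    using \<alpha>c \<beta>c \<alpha>(2) \<beta>(2) by (auto intro: borel_measurable_continuous_onI)
  have \<rho>m [measurable]: "(\<lambda>x. \<rho> t x) \<in> borel_measurable borel" for t
    unfolding \<rho>_def by measurable
  have um [measurable]: "(\<lambda>x. u t x) \<in> borel_measurable borel" for t
    unfolding u_def by measurable
  define K\<rho> where "K\<rho> = \<bar>m\<bar> + L * C + L * C"
  define Ku where "Ku = L * R + L * R"
  have \<rho>K: "norm (\<rho> t x) \<le> K\<rho>" for t x
  proof -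
    have "\<bar>\<alpha> t * f0 x\<bar> \<le> L * C" "\<bar>\<beta> t * f1 x\<bar> \<le> L * C"
      unfolding abs_mult using \<alpha>(3) \<beta>(3) fC L C by (auto intro!: mult_mono)
    then show ?thesis unfolding \<rho>_def K\<rho>_def real_norm_def by linarith
  qed
  have uK: "norm (u t x) \<le> Ku" for t x
  proof -
    have "norm (\<alpha>' t *\<^sub>R w0 x) \<le> L * R" "norm (\<beta>' t *\<^sub>R w1 x) \<le> L * R"
      using \<alpha>(4) \<beta>(4) wR L R by (auto intro!: mult_mono)
    then show ?thesis
      unfolding u_def Ku_def by (intro order_trans[OF norm_triangle_ineq] add_mono)
  qed
  have \<rho>i: "integrable (gamma_dom S) (\<rho> t)" for t using \<rho>K by (intro integrable_bounded) auto
  have ui: "integrable (gamma_dom S) (u t)" for t using uK by (intro integrable_bounded) auto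
  have w0i: "integrable (gamma_dom S) w0" and w1i: "integrable (gamma_dom S) w1"
    using wR by (auto intro!: integrable_bounded)
  have weak: "weakstar_continuous_on {0..1} ?\<mu>"
    unfolding weakstar_continuous_on_def
  proof (intro allI impI, elim conjE)
    fix g :: "'a \<Rightarrow> real" assume g: "continuous_on UNIV g" "compact (supp_fun g)"
    have [measurable]: "g \<in> borel_measurable borel" using g(1) by (rule borel_measurable_continuous_onI)
    obtain B where B0: "0 \<le> B" and B: "\<And>x. norm (g x) \<le> B"
      by (rule bounded_if_compact_supp[OF g zero_outside_supp_fun[where h=g]]) blast+
    have i: "integrable (gamma_dom S) g" "integrable (gamma_dom S) (\<lambda>x. g x * f0 x)"
      "integrable (gamma_dom S) (\<lambda>x. g x * f1 x)"
    proof -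
      show "integrable (gamma_dom S) g" using B by (intro integrable_bounded[where K=B]) auto
      have "integrable (gamma_dom S) (\<lambda>x. g x * h x)"
        if [measurable]: "h \<in> borel_measurable borel" and h: "\<And>x. \<bar>h x\<bar> \<le> C" for h
      proof (rule integrable_bounded[where K="B * C"])
        show "norm (g x * h x) \<le> B * C" for x
          unfolding norm_mult using B[of x] h[of x] B0 by (intro mult_mono) auto
      qed measurable
      from this[OF f(1) fC(1)] this[OF f(2) fC(2)]
      show "integrable (gamma_dom S) (\<lambda>x. g x * f0 x)" "integrable (gamma_dom S) (\<lambda>x. g x * f1 x)" .
    qed
    have "signed_integral (?\<mu> t) g = (\<integral>x. g x * \<rho> t x \<partial>gamma_dom S)" for t
      using B by (intro signed_integral_with_density[OF \<rho>i]) auto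
    \<comment> \<open>Time enters only through the coefficients, so the pairing with
      \<open>g\<close> is a fixed combination of 1, \<open>\<alpha>\<close> and
      \<open>\<beta>\<close>.\<close>
    also have "(\<integral>x. g x * \<rho> t x \<partial>gamma_dom S) = (\<integral>x. m * g x + \<alpha> t * (g x * f0 x) + \<beta> t * (g x * f1 x) \<partial>gamma_dom S)" for t
      by (intro Bochner_Integration.integral_cong) (auto simp: \<rho>_def algebra_simps)
    also have "(\<integral>x. m * g x + \<alpha> t * (g x * f0 x) + \<beta> t * (g x * f1 x) \<partial>gamma_dom S)
      = m * (\<integral>x. g x \<partial>gamma_dom S) + \<alpha> t * (\<integral>x. g x * f0 x \<partial>gamma_dom S) + \<beta> t * (\<integral>x. g x * f1 x \<partial>gamma_dom S)" for t
      using i by simp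
    finally show "continuous_on {0..1} (\<lambda>t. signed_integral (?\<mu> t) g)"
      by (auto intro!: continuous_intros continuous_on_subset[OF \<alpha>c] continuous_on_subset[OF \<beta>c])
  qed
  have bor: "borel_family {0..1} ?\<nu>"
    unfolding borel_family_def
  proof
    fix B :: "'a set" assume B: "B \<in> bounded_borel"
    then have Bb: "B \<in> sets borel" by (simp add: bounded_borel_def)
    have "?\<nu> t B = \<alpha>' t *\<^sub>R set_lebesgue_integral (gamma_dom S) B w0 + \<beta>' t *\<^sub>R set_lebesgue_integral (gamma_dom S) B w1" for t
      using B set_integrable_sub[OF w0i Bb] set_integrable_sub[OF w1i Bb]
      by (simp add: with_density_def u_def[abs_def] set_integral_add(2))
    then show "(\<lambda>t. ?\<nu> t B) \<in> borel_measurable (restrict_space borel {0..1})"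
      by (auto intro!: measurable_restrict_space1)
  qed
  have eq: "(LINT t:{0..1}|lborel. signed_integral (?\<mu> t) (dt \<zeta> t)) +
      (LINT t:{0..1}|lborel. vector_integral (?\<nu> t) (grad_x \<zeta> t)) = 0"
    if "Ck 1 \<zeta>" "compact (supp_fun \<zeta>)" "supp_fun \<zeta> \<subseteq> UNIV \<times> {0<..<1}" for \<zeta>
  proof -
    interpret test_function \<zeta> by standard fact+
    obtain B where B0: "0 \<le> B" and B: "\<And>p. \<bar>\<zeta> p\<bar> \<le> B" "\<And>t x. \<bar>dt \<zeta> t x\<bar> \<le> B" "\<And>t x. norm (grad_x \<zeta> t x) \<le> B"
      by (rule bounds) blast
    have swap: "(\<lambda>(t, x). h (x, t)) \<in> borel_measurable (borel \<Otimes>\<^sub>M borel)"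
      if "continuous_on UNIV h" for h :: "'a \<times> real \<Rightarrow> real"
    proof -
      have "h \<in> borel_measurable (borel \<Otimes>\<^sub>M borel)"
        using borel_measurable_continuous_onI[OF that] by (simp add: borel_prod)
      then show ?thesis by measurable
    qed
    have \<zeta>m [measurable]: "(\<lambda>(t, x). \<zeta> (x, t)) \<in> borel_measurable (borel \<Otimes>\<^sub>M borel)"
      by (rule swap[OF cont])
    have dtm [measurable]: "(\<lambda>(t, x). dt \<zeta> t x) \<in> borel_measurable (borel \<Otimes>\<^sub>M borel)"
      using swap[OF dt_continuous] by simp
    have gradc: "continuous_on UNIV (grad_x \<zeta> t)" for t
      using continuous_on_compose2[OF grad_continuous continuous_on_Pair[OF continuous_on_id continuous_on_const]] by simp
    have gradm [measurable]: "grad_x \<zeta> t \<in> borel_measurable borel" for t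
      using gradc by (rule borel_measurable_continuous_onI)
    have dtm1 [measurable]: "dt \<zeta> t \<in> borel_measurable borel" for t
      using measurable_compose_Pair1[OF _ dtm, of t] by simp
    have \<zeta>m1 [measurable]: "(\<lambda>x. \<zeta> (x, t)) \<in> borel_measurable borel" for t
      using measurable_compose_Pair1[OF _ \<zeta>m, of t] by simp
    define \<rho>' where "\<rho>' t x = \<alpha>' t * f0 x + \<beta>' t * f1 x" for t x
    have \<rho>'K: "\<bar>\<rho>' t x\<bar> \<le> L * C + L * C" for t x
    proof -
      have "\<bar>\<alpha>' t * f0 x\<bar> \<le> L * C" "\<bar>\<beta>' t * f1 x\<bar> \<le> L * C"
        unfolding abs_mult using \<alpha>(4) \<beta>(4) fC L C by (auto intro!: mult_mono)
      then show ?thesis unfolding \<rho>'_def by linarith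
    qed
    have \<rho>mm [measurable]: "(\<lambda>(t, x). \<rho> t x) \<in> borel_measurable (borel \<Otimes>\<^sub>M borel)"
      unfolding \<rho>_def by measurable
    have \<rho>'mm [measurable]: "(\<lambda>(t, x). \<rho>' t x) \<in> borel_measurable (borel \<Otimes>\<^sub>M borel)"
      unfolding \<rho>'_def by measurable
    \<comment> \<open>\<open>H1\<close> and \<open>H2\<close> are the two terms of the product rule
      for \<open>\<zeta> (x, t) * \<rho> t x\<close> in \<open>t\<close>.\<close>
    define H1 where "H1 t x = dt \<zeta> t x * \<rho> t x" for t x
    define H2 where "H2 t x = \<zeta> (x, t) * \<rho>' t x" for t x
    have H1m [measurable]: "(\<lambda>(t, x). H1 t x) \<in> borel_measurable (borel \<Otimes>\<^sub>M borel)"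
      unfolding H1_def by measurable
    have H2m [measurable]: "(\<lambda>(t, x). H2 t x) \<in> borel_measurable (borel \<Otimes>\<^sub>M borel)"
      unfolding H2_def by measurable
    have H1K: "\<bar>H1 t x\<bar> \<le> B * K\<rho>" for t x
      unfolding H1_def abs_mult using B(2)[of t x] \<rho>K[of t x] B0 by (intro mult_mono) auto
    have H2K: "\<bar>H2 t x\<bar> \<le> B * (L * C + L * C)" for t x
      unfolding H2_def abs_mult using B(1)[of "(x, t)"] \<rho>'K[of t x] B0 by (intro mult_mono) auto
    have s: "signed_integral (?\<mu> t) (dt \<zeta> t) = (\<integral>x. H1 t x \<partial>gamma_dom S)" for t
      unfolding H1_def using B by (intro signed_integral_with_density[OF \<rho>i]) auto
    have v: "vector_integral (?\<nu> t) (grad_x \<zeta> t) = (\<integral>x. H2 t x \<partial>gamma_dom S)" for t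
    proof -
      have d0: "(\<integral>x. f0 x * \<zeta> (x, t) \<partial>gamma_dom S) = (\<integral>x. grad_x \<zeta> t x \<bullet> w0 x \<partial>gamma_dom S)"
        and d1: "(\<integral>x. f1 x * \<zeta> (x, t) \<partial>gamma_dom S) = (\<integral>x. grad_x \<zeta> t x \<bullet> w1 x \<partial>gamma_dom S)"
        using div0 div1 deriv_space gradc B unfolding neg_weak_divergence_def by blast+
      have gi: "integrable (gamma_dom S) (\<lambda>x. grad_x \<zeta> t x \<bullet> h x)"
        if [measurable]: "h \<in> borel_measurable borel" and h: "\<And>x. norm (h x) \<le> R" for h
      proof (rule integrable_bounded[where K="B * R"])
        fix x
        have "norm (grad_x \<zeta> t x) * norm (h x) \<le> B * R" using B B0 h by (intro mult_mono) auto
        then show "norm (grad_x \<zeta> t x \<bullet> h x) \<le> B * R"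
          using Cauchy_Schwarz_ineq2[of "grad_x \<zeta> t x" "h x"] by simp
      qed measurable
      have fi: "integrable (gamma_dom S) (\<lambda>x. h x * \<zeta> (x, t))"
        if [measurable]: "h \<in> borel_measurable borel" and h: "\<And>x. \<bar>h x\<bar> \<le> C" for h
      proof (rule integrable_bounded[where K="C * B"])
        show "norm (h x * \<zeta> (x, t)) \<le> C * B" for x
          unfolding norm_mult using B(1)[of "(x, t)"] h[of x] C by (intro mult_mono) auto
      qed measurable
      have "vector_integral (?\<nu> t) (grad_x \<zeta> t) = (\<integral>x. grad_x \<zeta> t x \<bullet> u t x \<partial>gamma_dom S)"
        using B by (intro vector_integral_with_density[OF ui]) auto
      also have "\<dots> = (\<integral>x. \<alpha>' t * (grad_x \<zeta> t x \<bullet> w0 x) + \<beta>' t * (grad_x \<zeta> t x \<bullet> w1 x) \<partial>gamma_dom S)"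
        by (simp add: u_def inner_add_right)
      also have "\<dots> = \<alpha>' t * (\<integral>x. grad_x \<zeta> t x \<bullet> w0 x \<partial>gamma_dom S) + \<beta>' t * (\<integral>x. grad_x \<zeta> t x \<bullet> w1 x \<partial>gamma_dom S)"
        using gi[OF w(1) wR(1)] gi[OF w(2) wR(2)] by simp
      also have "\<dots> = (\<integral>x. \<alpha>' t * (f0 x * \<zeta> (x, t)) + \<beta>' t * (f1 x * \<zeta> (x, t)) \<partial>gamma_dom S)"
        using fi[OF f(1) fC(1)] fi[OF f(2) fC(2)] by (simp add: d0 d1)
      also have "\<dots> = (\<integral>x. H2 t x \<partial>gamma_dom S)"
        by (intro Bochner_Integration.integral_cong) (auto simp: H2_def \<rho>'_def algebra_simps)
      finally show ?thesis .
    qed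
    have i1: "integrable (gamma_dom {0..1::real} \<Otimes>\<^sub>M gamma_dom S) (\<lambda>(t, x). H1 t x)"
      and i2: "integrable (gamma_dom {0..1::real} \<Otimes>\<^sub>M gamma_dom S) (\<lambda>(t, x). H2 t x)"
      using H1K H2K
      by (auto intro!: finite_measure.integrable_const_bound[OF finite_measure_pair_measure[OF
              gam.finite_measure_axioms I.gam.finite_measure_axioms]] AE_I2)
    interpret P: pair_sigma_finite "gamma_dom {0..1::real}" "gamma_dom S" ..
    \<comment> \<open>For fixed \<open>x\<close> this is the fundamental theorem of calculus with
      boundary terms 0. No regularity of the densities in \<open>x\<close> is involved, which is why
      time is integrated first after Fubini.\<close>
    have inner: "(\<integral>t. H1 t x + H2 t x \<partial>gamma_dom {0..1}) = 0" for x
    proof -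
      have dc: "continuous_on UNIV (\<lambda>t. dt \<zeta> t x)"
        using continuous_on_compose2[OF dt_continuous continuous_on_Pair[OF continuous_on_const continuous_on_id]] by simp
      have zc: "continuous_on UNIV (\<lambda>t. \<zeta> (x, t))"
        using continuous_on_compose2[OF cont continuous_on_Pair[OF continuous_on_const continuous_on_id]] by simp
      have c: "continuous_on UNIV (\<lambda>t. H1 t x + H2 t x)"
        unfolding H1_def H2_def \<rho>_def \<rho>'_def
        by (intro continuous_intros dc zc \<alpha>c \<beta>c \<alpha>(2) \<beta>(2))
      have D: "((\<lambda>t. \<zeta> (x, t) * \<rho> t x) has_vector_derivative H1 t x + H2 t x) (at t within {0..1})" for t
      proof -
        have "((\<lambda>t. \<rho> t x) has_real_derivative \<rho>' t x) (at t)"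
          unfolding \<rho>_def \<rho>'_def by (auto intro!: derivative_eq_intros \<alpha>(1) \<beta>(1))
        from DERIV_mult[OF deriv_time this]
        have "((\<lambda>t. \<zeta> (x, t) * \<rho> t x) has_real_derivative H1 t x + H2 t x) (at t)"
          by (simp add: H1_def H2_def algebra_simps)
        then show ?thesis
          by (simp add: has_real_derivative_iff_has_vector_derivative has_vector_derivative_at_within)
      qed
      have "(\<integral>t. H1 t x + H2 t x \<partial>gamma_dom {0..1}) = (LINT t:{0..1}|lborel. H1 t x + H2 t x)"
        using borel_measurable_continuous_onI[OF c] by (simp add: LINT_eq_gamma_dom)
      also have "\<dots> = \<zeta> (x, 1) * \<rho> 1 x - \<zeta> (x, 0) * \<rho> 0 x"
        unfolding set_lebesgue_integral_def
        by (rule integral_FTC_atLeastAtMost[where F="\<lambda>t. \<zeta> (x, t) * \<rho> t x"])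
          (auto intro: D continuous_on_subset[OF c])
      finally show ?thesis by (simp add: zero_ends)
    qed
    have "(LINT t:{0..1}|lborel. signed_integral (?\<mu> t) (dt \<zeta> t)) +
        (LINT t:{0..1}|lborel. vector_integral (?\<nu> t) (grad_x \<zeta> t))
      = (\<integral>t. \<integral>x. H1 t x \<partial>gamma_dom S \<partial>gamma_dom {0..1}) + (\<integral>t. \<integral>x. H2 t x \<partial>gamma_dom S \<partial>gamma_dom {0..1})"
      unfolding s v by (subst (1 2) LINT_eq_gamma_dom) auto
    also have "\<dots> = (\<integral>p. (\<lambda>(t, x). H1 t x) p \<partial>(gamma_dom {0..1} \<Otimes>\<^sub>M gamma_dom S))
        + (\<integral>p. (\<lambda>(t, x). H2 t x) p \<partial>(gamma_dom {0..1} \<Otimes>\<^sub>M gamma_dom S))"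
      using P.integral_fst[OF i1] P.integral_fst[OF i2] by simp
    also have "\<dots> = (\<integral>p. (\<lambda>(t, x). H1 t x + H2 t x) p \<partial>(gamma_dom {0..1} \<Otimes>\<^sub>M gamma_dom S))"
      using Bochner_Integration.integral_add[OF i1 i2] by (simp add: split_def)
    also have "\<dots> = (\<integral>x. \<integral>t. H1 t x + H2 t x \<partial>gamma_dom {0..1} \<partial>gamma_dom S)"
      using Bochner_Integration.integrable_add[OF i1 i2] by (intro P.integral_snd[symmetric]) (simp add: split_def)
    also have "\<dots> = 0" by (simp add: inner)
    finally show ?thesis .
  qed
  have "(?\<mu>, ?\<nu>) \<in> CE 1"
    unfolding CE_def
    using weak bor radon_with_density[OF \<rho>i] radon_with_density[OF ui] eq
      total_variation_path_finite[of \<rho>, OF \<rho>m \<rho>K] total_variation_path_finite[of u, OF um uK] by auto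
  then show ?thesis by (simp only: \<rho>_def[abs_def] u_def[abs_def])
qed

section \<open>Uniform bound on the action of the connecting path\<close>

lemma M_space_bounded_density:
  assumes "\<mu> \<in> M_space a b c S" "a \<le> b"
  obtains \<rho> where "\<rho> \<in> borel_measurable borel" "\<And>x. a \<le> \<rho> x \<and> \<rho> x \<le> b"
    "\<mu> = with_density \<rho> (gamma_dom S)" "(\<integral>x. \<rho> x \<partial>gamma_dom S) = c"
proof -
  obtain r where r: "loc_integrable (gamma_dom S) r" and \<mu>: "\<mu> = with_density r (gamma_dom S)"
    and ab: "AE x in gamma_dom S. a \<le> r x \<and> r x \<le> b" and c: "\<mu> (closure S) = c"
    using assms(1) unfolding M_space_def by blast
  have [measurable]: "r \<in> borel_measurable borel" using r by (simp add: loc_integrable_def)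
  \<comment> \<open>Clamping to the interval changes the density only on a null set and makes the
    bounds hold at every point, as the later estimates require.\<close>
  define \<rho> where "\<rho> x = max a (min b (r x))" for x
  have [measurable]: "\<rho> \<in> borel_measurable borel" unfolding \<rho>_def by measurable
  have eq: "AE x in gamma_dom S. r x = \<rho> x" using ab by (auto simp: \<rho>_def)
  have "set_lebesgue_integral (gamma_dom S) B r = set_lebesgue_integral (gamma_dom S) B \<rho>"
    if "B \<in> sets borel" for B
    unfolding set_lebesgue_integral_def using eq that by (intro integral_cong_AE) auto
  then have \<mu>': "\<mu> = with_density \<rho> (gamma_dom S)"
    unfolding \<mu> with_density_def by (auto simp: bounded_borel_def)
  have [measurable]: "closure S \<in> sets borel" by simp
  have "closure S \<in> bounded_borel"
    using bdd_S by (auto simp: bounded_borel_def)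
  then have "c = set_lebesgue_integral (gamma_dom S) (closure S) \<rho>"
    using c \<mu>' by (simp add: with_density_def)
  also have "\<dots> = (\<integral>x. \<rho> x \<partial>gamma_dom S)"
    unfolding set_lebesgue_integral_def
  proof (rule integral_cong_AE)
    show "AE x in gamma_dom S. indicat_real (closure S) x *\<^sub>R \<rho> x = \<rho> x"
      using AE_gamma_dom[OF borel_S] by eventually_elim (use closure_subset[of S] in auto)
  qed measurable
  finally show ?thesis
    using that[of \<rho>] \<mu>' assms(2) by (auto simp: \<rho>_def)
qed

lemma density_bound_on_path:
  fixes w0 w1 :: 'a
  assumes \<phi>: "\<phi> \<in> admissible_on 2 a b" and m: "m \<in> {a<..<b}"
    and K: "0 \<le> K" "\<And>w. norm w \<le> R \<Longrightarrow> \<phi> (m, w) \<le> ennreal K"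
    and w: "norm w0 \<le> R" "norm w1 \<le> R" and r: "a \<le> r0" "r0 \<le> b" "a \<le> r1" "r1 \<le> b"
    and cs: "0 < co" "0 < si" "co\<^sup>2 + si\<^sup>2 = 1"
  shows "\<phi> (m + co ^ 4 * (r0 - m) + si ^ 4 * (r1 - m),
      (- (2 * pi * co ^ 3 * si)) *\<^sub>R w0 + (2 * pi * si ^ 3 * co) *\<^sub>R w1) \<le> ennreal (4 * pi\<^sup>2 * K)"
proof -
  \<comment> \<open>Half of the fraction \<open>2 * u\<close> of \<open>m\<close> present in the
    density: one copy of \<open>u\<close> will carry the momentum, the other stays in
    \<open>r\<close> below.\<close>
  define u where "u = co\<^sup>2 * si\<^sup>2"
  have "(co\<^sup>2 + si\<^sup>2)\<^sup>2 = 1" using cs by simp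
  then have sum1: "co ^ 4 + si ^ 4 = 1 - 2 * u"
    by (simp add: u_def power2_eq_square power4_eq_xxxx algebra_simps)
  have u: "0 < u" "2 * u \<le> 1"
    using cs sum1 by (auto simp: u_def) (smt (verit) zero_le_even_power even_numeral)
  define \<rho> where "\<rho> = m + co ^ 4 * (r0 - m) + si ^ 4 * (r1 - m)"
  have \<rho>: "\<rho> = co ^ 4 * r0 + si ^ 4 * r1 + 2 * u * m"
  proof -
    have "\<rho> = co ^ 4 * r0 + si ^ 4 * r1 + (1 - (co ^ 4 + si ^ 4)) * m"
      by (simp add: \<rho>_def algebra_simps)
    then show ?thesis by (simp add: sum1)
  qed
  have lo: "(1 - 2 * u) * a + 2 * u * m \<le> \<rho>"
  proof -
    have "co ^ 4 * a + si ^ 4 * a \<le> co ^ 4 * r0 + si ^ 4 * r1"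
      using r by (intro add_mono mult_left_mono) auto
    then show ?thesis unfolding \<rho> sum1[symmetric] by (simp add: distrib_right)
  qed
  have hi: "\<rho> \<le> (1 - 2 * u) * b + 2 * u * m"
  proof -
    have "co ^ 4 * r0 + si ^ 4 * r1 \<le> co ^ 4 * b + si ^ 4 * b"
      using r by (intro add_mono mult_left_mono) auto
    then show ?thesis unfolding \<rho> sum1[symmetric] by (simp add: distrib_right)
  qed
  have um: "u * a < u * m" "u * m < u * b" using u m by auto
  \<comment> \<open>What is left of the density after the momentum-carrying share of
    \<open>m\<close> is taken out, renormalized. The second share of \<open>m\<close> makes it
    strictly interior even if \<open>r0\<close> and \<open>r1\<close> equal \<open>a\<close> or
    \<open>b\<close>, so \<open>\<phi> (r, 0) = 0\<close>.\<close>
  define r where "r = (\<rho> - u * m) / (1 - u)"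
  have r_in: "r \<in> {a<..<b}"
  proof -
    have "a * (1 - u) < \<rho> - u * m" "\<rho> - u * m < b * (1 - u)"
      using lo hi um by (auto simp: algebra_simps)
    then show ?thesis using u by (auto simp: r_def field_simps)
  qed
  have r_eq: "(1 - u) * r + u * m = \<rho>" using u by (simp add: r_def)
  \<comment> \<open>The velocity without its common factor \<open>2 * pi * co * si\<close>. It is a
    convex combination of \<open>- w0\<close> and \<open>w1\<close>, so it stays in the ball of
    radius \<open>R\<close>.\<close>
  define v where "v = (- co\<^sup>2) *\<^sub>R w0 + si\<^sup>2 *\<^sub>R w1"
  have v: "norm v \<le> R"
  proof -
    have "norm v \<le> norm ((- co\<^sup>2) *\<^sub>R w0) + norm (si\<^sup>2 *\<^sub>R w1)"
      unfolding v_def by (rule norm_triangle_ineq)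
    also have "\<dots> \<le> co\<^sup>2 * R + si\<^sup>2 * R"
      using w by (auto intro!: add_mono mult_left_mono)
    also have "\<dots> = R" using cs(3) by (simp flip: distrib_right)
    finally show ?thesis .
  qed
  have w_eq: "(- (2 * pi * co ^ 3 * si)) *\<^sub>R w0 + (2 * pi * si ^ 3 * co) *\<^sub>R w1 = (2 * pi * co * si) *\<^sub>R v"
    by (simp add: v_def scaleR_right_distrib scaleR_right_diff_distrib power2_eq_square power3_eq_cube mult_ac)
  have "\<phi> (\<rho>, (2 * pi * co * si) *\<^sub>R v) \<le> ennreal (1 / u) * \<phi> (m, (2 * pi * co * si) *\<^sub>R v)"
    using admissible_on_interpolate[OF \<phi> r_in m, of u] u r_eq by simp
  also have "\<phi> (m, (2 * pi * co * si) *\<^sub>R v) = ennreal ((2 * pi * co * si)\<^sup>2) * \<phi> (m, v)"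
    using admissible_on_homogeneous(2)[OF \<phi> m, of "2 * pi * co * si" v] cs by (simp add: abs_mult powr_numeral)
  \<comment> \<open>The cancellation for which the path was designed: the square of
    \<open>2 * pi * co * si\<close> divided by \<open>u\<close> is the constant
    \<open>4 * pi\<^sup>2\<close>.\<close>
  also have "ennreal (1 / u) * (ennreal ((2 * pi * co * si)\<^sup>2) * \<phi> (m, v)) = ennreal (4 * pi\<^sup>2) * \<phi> (m, v)"
    using u cs by (simp add: mult.assoc[symmetric] ennreal_mult'[symmetric] u_def power_mult_distrib)
  also have "\<dots> \<le> ennreal (4 * pi\<^sup>2) * ennreal K"
    by (intro mult_left_mono K v) auto
  finally show ?thesis
    using K(1) unfolding w_eq \<rho>_def by (simp add: ennreal_mult)
qed

text \<open>Uniformity comes from fixing \<open>m\<close>, \<open>D\<close>, \<open>R\<close> and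
  \<open>K\<close> before the two measures; they depend only on \<open>\<phi>\<close>,
  \<open>S\<close>, \<open>a\<close>, \<open>b\<close> and \<open>c\<close>.\<close>

lemma W_dist_bounded:
  assumes ab: "a < b" and \<phi>: "\<phi> \<in> admissible_on 2 a b"
    and c: "a * measure lborel S < c" "c < b * measure lborel S"
  obtains K where "\<And>\<mu>0 \<mu>1. \<mu>0 \<in> M_space a b c S \<Longrightarrow> \<mu>1 \<in> M_space a b c S \<Longrightarrow>
    W_dist 2 \<phi> (gamma_dom S) \<mu>0 \<mu>1 \<le> ennreal K"
proof -
  define V where "V = measure (gamma_dom S) UNIV"
  have V: "0 < V" unfolding V_def by (rule measure_pos)
  define m where "m = c / V"
  have m: "m \<in> {a<..<b}"
    using c V by (simp add: m_def V_def measure_gamma_dom[symmetric] field_simps)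
  obtain D where D: "\<And>f C. f \<in> borel_measurable borel \<Longrightarrow> (\<And>x. \<bar>f x\<bar> \<le> C) \<Longrightarrow>
      (\<integral>x. f x \<partial>gamma_dom S) = 0 \<Longrightarrow>
      \<exists>w\<in>borel_measurable borel. (\<forall>x. norm (w x) \<le> C * D) \<and> neg_weak_divergence w f"
    by (rule bounded_divergence_solution) blast
  \<comment> \<open>Both a density in the interval and its mean \<open>m\<close> lie between
    \<open>a\<close> and \<open>b\<close>, so \<open>b - a\<close> bounds their difference.\<close>
  define R where "R = (b - a) * D"
  obtain K where K: "0 \<le> K" "\<And>w. norm w \<le> R \<Longrightarrow> \<phi> (m, w) \<le> ennreal K"
    by (rule admissible_on_bounded_ball[OF \<phi> m, of R]) blast
  have ne: "edom \<phi> \<noteq> {}"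
    using \<phi> by (simp add: admissible_on_def admissible_def)
  let ?A = "4 * pi\<^sup>2 * K * V"
  have "W_dist 2 \<phi> (gamma_dom S) \<mu>0 \<mu>1 \<le> ennreal (?A powr (1 / 2))"
    if \<mu>0: "\<mu>0 \<in> M_space a b c S" and \<mu>1: "\<mu>1 \<in> M_space a b c S" for \<mu>0 \<mu>1
  proof -
    obtain \<rho>0 where \<rho>0 [measurable]: "\<rho>0 \<in> borel_measurable borel" and ab0: "\<And>x. a \<le> \<rho>0 x \<and> \<rho>0 x \<le> b"
      and eq0: "\<mu>0 = with_density \<rho>0 (gamma_dom S)" and int0: "(\<integral>x. \<rho>0 x \<partial>gamma_dom S) = c"
      by (rule M_space_bounded_density[OF \<mu>0 less_imp_le[OF ab]]) blast
    obtain \<rho>1 where \<rho>1 [measurable]: "\<rho>1 \<in> borel_measurable borel" and ab1: "\<And>x. a \<le> \<rho>1 x \<and> \<rho>1 x \<le> b"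
      and eq1: "\<mu>1 = with_density \<rho>1 (gamma_dom S)" and int1: "(\<integral>x. \<rho>1 x \<partial>gamma_dom S) = c"
      by (rule M_space_bounded_density[OF \<mu>1 less_imp_le[OF ab]]) blast
    have sol: "\<exists>w\<in>borel_measurable borel. (\<forall>x. norm (w x) \<le> R) \<and> neg_weak_divergence w (\<lambda>x. \<rho> x - m)"
      if [measurable]: "\<rho> \<in> borel_measurable borel" and "\<And>x. a \<le> \<rho> x \<and> \<rho> x \<le> b"
        and "(\<integral>x. \<rho> x \<partial>gamma_dom S) = c" for \<rho>
      unfolding R_def
    proof (rule D)
      show "\<bar>\<rho> x - m\<bar> \<le> b - a" for x using that(2)[of x] m by auto
      have "\<bar>\<rho> x\<bar> \<le> \<bar>a\<bar> + \<bar>b\<bar>" for x using that(2)[of x] by auto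
      then have "integrable (gamma_dom S) \<rho>" by (intro integrable_bounded[where K="\<bar>a\<bar> + \<bar>b\<bar>"]) auto
      then show "(\<integral>x. \<rho> x - m \<partial>gamma_dom S) = 0"
        using that(3) V by (simp add: m_def V_def)
    qed measurable
    obtain w0 where w0 [measurable]: "w0 \<in> borel_measurable borel" and w0R: "\<And>x. norm (w0 x) \<le> R"
      and div0: "neg_weak_divergence w0 (\<lambda>x. \<rho>0 x - m)"
      using sol[OF \<rho>0 ab0 int0] by blast
    obtain w1 where w1 [measurable]: "w1 \<in> borel_measurable borel" and w1R: "\<And>x. norm (w1 x) \<le> R"
      and div1: "neg_weak_divergence w1 (\<lambda>x. \<rho>1 x - m)"
      using sol[OF \<rho>1 ab1 int1] by blast
    define co where "co t = cos (pi / 2 * t)" for t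
    define si where "si t = sin (pi / 2 * t)" for t
    have dco: "(co has_real_derivative - (si t * (pi / 2))) (at t)" for t
      unfolding co_def si_def by (auto intro!: derivative_eq_intros)
    have dsi: "(si has_real_derivative co t * (pi / 2)) (at t)" for t
      unfolding co_def si_def by (auto intro!: derivative_eq_intros)
    have c_co: "continuous_on UNIV co" and c_si: "continuous_on UNIV si"
      unfolding co_def si_def by (auto intro!: continuous_intros)
    have co1: "\<bar>co t\<bar> \<le> 1" and si1: "\<bar>si t\<bar> \<le> 1" for t
      by (auto simp: co_def si_def)
    have pow1: "\<bar>x ^ n\<bar> \<le> 1" if "\<bar>x\<bar> \<le> 1" for x :: real and n
      using that by (simp add: power_abs power_le_one)
    define \<mu> where "\<mu> t = with_density (\<lambda>x. m + co t ^ 4 * (\<rho>0 x - m) + si t ^ 4 * (\<rho>1 x - m)) (gamma_dom S)" for t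
    define \<nu> where "\<nu> t = with_density (\<lambda>x. (- (2 * pi * co t ^ 3 * si t)) *\<^sub>R w0 x + (2 * pi * si t ^ 3 * co t) *\<^sub>R w1 x) (gamma_dom S)" for t
    have CE: "(\<mu>, \<nu>) \<in> CE 1"
      unfolding \<mu>_def[abs_def] \<nu>_def[abs_def]
    \<comment> \<open>The derivatives of the fourth powers carry the factor
      \<open>4 * (pi / 2)\<close>; the resulting \<open>2 * pi\<close> also exceeds 1 and so bounds
      the powers themselves.\<close>
    proof (rule with_density_path_in_CE[OF _ _ _ _ w0 w1 w0R w1R div0 div1, where C="b - a" and L="2 * pi"])
      show "\<bar>\<rho>0 x - m\<bar> \<le> b - a" "\<bar>\<rho>1 x - m\<bar> \<le> b - a" for x
        using ab0[of x] ab1[of x] m by auto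
      show "((\<lambda>t. co t ^ 4) has_real_derivative - (2 * pi * co t ^ 3 * si t)) (at t)" for t
        by (rule derivative_eq_intros dco)+ simp
      show "((\<lambda>t. si t ^ 4) has_real_derivative 2 * pi * si t ^ 3 * co t) (at t)" for t
        by (rule derivative_eq_intros dsi)+ simp
      have "1 \<le> 2 * pi" using pi_ge_two by linarith
      then show "\<bar>co t ^ 4\<bar> \<le> 2 * pi" "\<bar>si t ^ 4\<bar> \<le> 2 * pi" for t
        using pow1[OF co1, of t 4] pow1[OF si1, of t 4] by linarith+
      have "\<bar>x ^ 3\<bar> * \<bar>y\<bar> \<le> 1 * 1" if "\<bar>x\<bar> \<le> 1" "\<bar>y\<bar> \<le> 1" for x y :: real
        using that pow1[OF that(1)] by (intro mult_mono) auto
      then show "\<bar>- (2 * pi * co t ^ 3 * si t)\<bar> \<le> 2 * pi" "\<bar>2 * pi * si t ^ 3 * co t\<bar> \<le> 2 * pi" for t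
        using co1 si1 by (auto simp: abs_mult mult.assoc)
      show "continuous_on UNIV (\<lambda>t. - (2 * pi * co t ^ 3 * si t))"
        "continuous_on UNIV (\<lambda>t. 2 * pi * si t ^ 3 * co t)"
        by (intro continuous_intros c_co c_si)+
    qed measurable
    have start: "\<mu> 0 = \<mu>0" and stop: "\<mu> 1 = \<mu>1"
      by (auto simp: \<mu>_def eq0 eq1 co_def si_def)
    have supp: "msupp (\<mu> t) \<subseteq> msupp (emeasure (gamma_dom S))" "msupp (\<nu> t) \<subseteq> msupp (emeasure (gamma_dom S))" for t
      unfolding \<mu>_def \<nu>_def by (rule msupp_with_density)+
    have act: "action \<phi> (\<mu> t) (\<nu> t) (gamma_dom S) \<le> ennreal ?A" if t: "t \<in> {0<..<1}" for t
    proof -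
      have cs: "0 < co t" "0 < si t" "(co t)\<^sup>2 + (si t)\<^sup>2 = 1"
        using t by (auto simp: co_def si_def intro!: cos_gt_zero sin_gt_zero2)
      have "loc_integrable (gamma_dom S) (\<lambda>x. m + co t ^ 4 * (\<rho>0 x - m) + si t ^ 4 * (\<rho>1 x - m))"
      proof (rule loc_integrable_bounded[where K="\<bar>m\<bar> + 1 * (b - a) + 1 * (b - a)"])
        fix x
        have fC: "\<bar>\<rho>0 x - m\<bar> \<le> b - a" "\<bar>\<rho>1 x - m\<bar> \<le> b - a"
          using ab0[of x] ab1[of x] m by auto
        have "\<bar>co t ^ 4 * (\<rho>0 x - m)\<bar> \<le> 1 * (b - a)" "\<bar>si t ^ 4 * (\<rho>1 x - m)\<bar> \<le> 1 * (b - a)"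
          unfolding abs_mult using pow1[OF co1, of t 4] pow1[OF si1, of t 4] fC by (intro mult_mono; simp)+
        then show "norm (m + co t ^ 4 * (\<rho>0 x - m) + si t ^ 4 * (\<rho>1 x - m)) \<le> \<bar>m\<bar> + 1 * (b - a) + 1 * (b - a)"
          unfolding real_norm_def by linarith
      qed measurable
      moreover have "loc_integrable (gamma_dom S) (\<lambda>x. (- (2 * pi * co t ^ 3 * si t)) *\<^sub>R w0 x + (2 * pi * si t ^ 3 * co t) *\<^sub>R w1 x)"
      proof (rule loc_integrable_bounded[where K="\<bar>2 * pi * co t ^ 3 * si t\<bar> * R + \<bar>2 * pi * si t ^ 3 * co t\<bar> * R"])
        show "norm ((- (2 * pi * co t ^ 3 * si t)) *\<^sub>R w0 x + (2 * pi * si t ^ 3 * co t) *\<^sub>R w1 x)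
          \<le> \<bar>2 * pi * co t ^ 3 * si t\<bar> * R + \<bar>2 * pi * si t ^ 3 * co t\<bar> * R" for x
          by (rule order_trans[OF norm_triangle_ineq])
            (auto intro!: add_mono mult_left_mono w0R w1R simp only: norm_scaleR abs_minus_cancel abs_ge_zero)
      qed measurable
      ultimately have "action \<phi> (\<mu> t) (\<nu> t) (gamma_dom S)
        = (\<integral>\<^sup>+ x. \<phi> (m + co t ^ 4 * (\<rho>0 x - m) + si t ^ 4 * (\<rho>1 x - m),
            (- (2 * pi * co t ^ 3 * si t)) *\<^sub>R w0 x + (2 * pi * si t ^ 3 * co t) *\<^sub>R w1 x) \<partial>gamma_dom S)"
        unfolding \<mu>_def \<nu>_def by (rule action_with_density[OF _ _ ne])
      also have "\<dots> \<le> (\<integral>\<^sup>+ x. ennreal (4 * pi\<^sup>2 * K) \<partial>gamma_dom S)"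
        using ab0 ab1 by (intro nn_integral_mono density_bound_on_path[OF \<phi> m K w0R w1R _ _ _ _ cs]) auto
      also have "\<dots> = ennreal ?A"
        using K by (simp add: gam.emeasure_eq_measure V_def ennreal_mult)
      finally show ?thesis .
    qed
    have "(\<integral>\<^sup>+ t\<in>{0..1}. action \<phi> (\<mu> t) (\<nu> t) (gamma_dom S) \<partial>lborel)
        \<le> (\<integral>\<^sup>+ t\<in>{0..1::real}. ennreal ?A \<partial>lborel)"
    proof (rule nn_integral_mono_AE)
      \<comment> \<open>The two end times form a null set, so the bound at interior times controls
        the time integral.\<close>
      have "AE t in lborel. t \<noteq> (0::real) \<and> t \<noteq> 1"
        using AE_lborel_singleton[of "0::real"] AE_lborel_singleton[of "1::real"] by auto
      then show "AE t in lborel. action \<phi> (\<mu> t) (\<nu> t) (gamma_dom S) * indicator {0..1} t \<le> ennreal ?A * indicator {0..1} t"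
        by eventually_elim (auto simp: indicator_def intro!: act)
    qed
    also have "\<dots> = ennreal ?A" by (simp add: nn_integral_cmult_indicator)
    finally have total: "(\<integral>\<^sup>+ t\<in>{0..1}. action \<phi> (\<mu> t) (\<nu> t) (gamma_dom S) \<partial>lborel) \<le> ennreal ?A" .
    then have "(\<mu>, \<nu>) \<in> CE_action \<phi> (gamma_dom S) \<mu>0 \<mu>1"
      unfolding CE_action_def using CE start stop supp by (auto intro: le_less_trans)
    moreover have "enn2real (\<integral>\<^sup>+ t\<in>{0..1}. action \<phi> (\<mu> t) (\<nu> t) (gamma_dom S) \<partial>lborel) \<le> ?A"
      using total K V by (intro enn2real_leI) auto
    then have "ennreal (enn2real (\<integral>\<^sup>+ t\<in>{0..1}. action \<phi> (\<mu> t) (\<nu> t) (gamma_dom S) \<partial>lborel) powr (1 / 2))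
        \<le> ennreal (?A powr (1 / 2))"
      by (intro ennreal_leI powr_mono2) auto
    ultimately show ?thesis
      unfolding W_dist_def by (intro INF_lower2[of "(\<mu>, \<nu>)"]) auto
  qed
  then show ?thesis using that by blast
qed

end

theorem theorem4p3:
  fixes a b :: real
    and \<phi> :: "real \<times> 'a::euclidean_space \<Rightarrow> ennreal"
    and \<Omega> :: "'a set"
  assumes "a < b"
    and "\<phi> \<in> admissible_on 2 a b"
    and "bounded \<Omega>" and "convex \<Omega>" and "smooth_domain \<Omega>"
  shows "\<forall>c \<in> {a * measure lborel \<Omega> <..< b * measure lborel \<Omega>}.
    (SUP (\<mu>0, \<mu>1) \<in> M_space a b c \<Omega> \<times> M_space a b c \<Omega>.
        W_dist 2 \<phi> (gamma_dom \<Omega>) \<mu>0 \<mu>1) < \<infinity> \<and>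
    (\<forall>\<mu>0 \<in> M_space a b c \<Omega>. \<forall>\<mu>1 \<in> M_space a b c \<Omega>.
        W_dist 2 \<phi> (gamma_dom \<Omega>) \<mu>0 \<mu>1 < \<infinity>)"
proof
  interpret bounded_convex_domain \<Omega>
    using assms by unfold_locales (auto simp: smooth_domain_def)
  fix c assume "c \<in> {a * measure lborel \<Omega> <..< b * measure lborel \<Omega>}"
  then have "a * measure lborel \<Omega> < c" "c < b * measure lborel \<Omega>" by auto
  then obtain K where K: "\<And>\<mu>0 \<mu>1. \<mu>0 \<in> M_space a b c \<Omega> \<Longrightarrow> \<mu>1 \<in> M_space a b c \<Omega> \<Longrightarrow>
      W_dist 2 \<phi> (gamma_dom \<Omega>) \<mu>0 \<mu>1 \<le> ennreal K"
    by (rule W_dist_bounded[OF assms(1,2)]) blast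
  have "(SUP (\<mu>0, \<mu>1) \<in> M_space a b c \<Omega> \<times> M_space a b c \<Omega>.
        W_dist 2 \<phi> (gamma_dom \<Omega>) \<mu>0 \<mu>1) \<le> ennreal K"
    using K by (intro SUP_least) auto
  then show "(SUP (\<mu>0, \<mu>1) \<in> M_space a b c \<Omega> \<times> M_space a b c \<Omega>.
        W_dist 2 \<phi> (gamma_dom \<Omega>) \<mu>0 \<mu>1) < \<infinity> \<and>
    (\<forall>\<mu>0 \<in> M_space a b c \<Omega>. \<forall>\<mu>1 \<in> M_space a b c \<Omega>.
        W_dist 2 \<phi> (gamma_dom \<Omega>) \<mu>0 \<mu>1 < \<infinity>)"
    using K by (auto intro: le_less_trans[OF _ ennreal_less_top])
qed

end
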